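(* Let $k_1\ge 1$ be an integer, $k_2 = k_1+1$, and recursively $k_i = 2k_{i-1} - k_{i-2} + 1$ for $i \geq 3$. Let $\mathcal T$ be a tent map with slope $a>1$ whose kneading map $Q$ satisfies (i) $Q(k_i) = k_i - 1$ for all $i \geq 3$; (ii) $Q(k_i + j) = Q(k_{i-1}+j-1)$ for all $i \geq 2$ and $1 \leq j < k_{i+1}-k_i$; (iii) $Q(k+1) > Q(Q^2(k)+1)+1$ for every $1\le k \le k_2+2$ for which $Q^2(k)=Q(Q(k))$ is defined (i.e. $Q(k)\ge 1$). Then $\mathcal T:\omega(c) \to \omega(c)$ is a homeomorphism.
   Context: A tent map with slope $a\in(1,2]$ is $\mathcal T:[0,1]\to[0,1]$, $\mathcal T(x)=\min(ax,a(1-x))$, with turning point $c=\frac12$. $\omega(c) = \bigcap_{i} \overline{\bigcup_{j \ge i} \{\mathcal T^j(c)\}}$. Cutting times and kneading map: if $J$ is a maximal closed interval on which $\mathcal T^n$ is monotone and $c\in\partial J$, then $\mathcal T^n:J\to \mathcal T^n(J)$ is called a central branch of $\mathcal T^n$. The two central branches of $\mathcal T^n$ have the same image, denoted $D_n$. The integer $n\ge1$ is a cutting time if $c \in D_n$. The cutting times are listed as $S_0<S_1<S_2<\dots$, and $S_0=1$, $S_1=2$. The difference of two consecutive cutting times is again a cutting time, so one can write $S_k = S_{k-1}+S_{Q(k)}$ for $k\ge1$; the function $Q:\mathbb N=\{1,2,\dots\}\to\mathbb N\cup\{0\}$, which satisfies $Q(k)<k$, is the kneading map of $\mathcal T$.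 *)

theory Defs
  imports "HOL-Analysis.Analysis" "HOL-Library.Infinite_Set"
begin

definition tent :: "real \<Rightarrow> real \<Rightarrow> real" where
  "tent a x = min (a * x) (a * (1 - x))"

definition turning_pt :: real where
  "turning_pt = 1 / 2"

definition omega_c :: "real \<Rightarrow> real set" where
  "omega_c a = (\<Inter>i::nat. closure (\<Union>j\<in>{i..}. {(tent a ^^ j) turning_pt}))"

definition monotone_interval :: "real \<Rightarrow> nat \<Rightarrow> real set \<Rightarrow> bool" where
  "monotone_interval a n J \<longleftrightarrow>
     (\<exists>u v. 0 \<le> u \<and> u \<le> v \<and> v \<le> 1 \<and> J = {u..v}) \<and>
     (mono_on J (tent a ^^ n) \<or> antimono_on J (tent a ^^ n))"

text \<open>
  The boundary point is \<open>1/2\<close>, an interior point of \<open>[0,1]\<close>, so it makes no difference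
  that the frontier is taken in the reals rather than in \<open>[0,1]\<close>.
\<close>

definition central_branch :: "real \<Rightarrow> nat \<Rightarrow> real set \<Rightarrow> bool" where
  "central_branch a n J \<longleftrightarrow>
     monotone_interval a n J \<and>
     (\<forall>J'. monotone_interval a n J' \<and> J \<subseteq> J' \<longrightarrow> J' = J) \<and>
     turning_pt \<in> frontier J"

text \<open>
  For \<open>n \<ge> 1\<close> there are exactly two central branches, mirror images of each other under
  \<open>x \<mapsto> 1 - x\<close>, so the common image is well defined. It is not meaningful for \<open>n = 0\<close>.
\<close>

definition central_image :: "real \<Rightarrow> nat \<Rightarrow> real set" where
  "central_image a n = (THE D. \<forall>J. central_branch a n J \<longrightarrow> (tent a ^^ n) ` J = D)"

definition is_cutting_time :: "real \<Rightarrow> nat \<Rightarrow> bool" where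
  "is_cutting_time a n \<longleftrightarrow> n \<ge> 1 \<and> turning_pt \<in> central_image a n"

text \<open>
  The enumeration is in increasing order and starts at index \<open>0\<close>. It is meaningful because
  there are infinitely many cutting times when \<open>1 < a \<le> 2\<close>.
\<close>

definition cutting_time :: "real \<Rightarrow> nat \<Rightarrow> nat" where
  "cutting_time a k = Infinite_Set.enumerate {n. is_cutting_time a n} k"

text \<open>Only the values at \<open>k \<ge> 1\<close> are meaningful.\<close>

definition kneading_map :: "real \<Rightarrow> nat \<Rightarrow> nat" where
  "kneading_map a k =
     (THE m. cutting_time a k = cutting_time a (k - 1) + cutting_time a m)"

end

theory Submission
  imports Defs
begin

text \<open>
  The map \<open>T\<close> is continuous, \<open>\<omega>(c)\<close> is compact and \<open>T\<close> maps it onto itself, so the restriction is a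
  homeomorphism as soon as it is injective. If \<open>c\<close> is periodic, \<open>\<omega>(c)\<close> is finite and surjectivity is
  enough. Otherwise, as \<open>T x = T y\<close> only for \<open>y \<in> {x, 1 - x}\<close>, one has to exclude that \<open>\<omega>(c)\<close> contains
  both \<open>x\<close> and \<open>1 - x\<close> for some \<open>x < c\<close>.

  Code the orbit \<open>c\<^sub>n\<close> of \<open>c\<close> by \<open>e n \<longleftrightarrow> c\<^sub>n > c\<close>. The cutting times and the kneading map are then
  determined by \<open>e\<close>: the first place where \<open>e (m + \<cdot>)\<close> differs from \<open>e\<close> is a cutting time \<open>S \<kappa>\<close> for every
  \<open>m \<ge> 1\<close>, with \<open>\<kappa> = Q (k + 1)\<close> when \<open>m = S k\<close>, and a large \<open>\<kappa>\<close> means that \<open>c\<^sub>m\<close> is close to \<open>c\<close>.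
  If \<open>c\<^sub>n\<close> is close to \<open>x\<close> and \<open>c\<^sub>m\<close> is close to \<open>1 - x\<close>, then \<open>e n \<noteq> e m\<close> while the two futures agree for
  a long time. There are two cases.

  If \<open>T\<^sup>t x = c\<close> for some \<open>t\<close>, then \<open>n + t\<close> and \<open>m + t\<close> are very close returns to \<open>c\<close>. The blocks of the
  kneading map all end with the same values (read backwards: \<open>Q (b 1)\<close>, \<open>Q (b 2)\<close>, \<open>b 3 - 1\<close>, \<open>b 4 - 1\<close>,
  and so on, if \<open>b i\<close> starts the \<open>i\<close>-th block), and therefore all very close returns have the same recent
  past (\<open>past_of_close_return\<close>). This contradicts \<open>e n \<noteq> e m\<close>.

  Otherwise the orbit of \<open>x\<close> avoids \<open>c\<close>, so at each later time \<open>t\<close> the index \<open>\<kappa>\<close> of \<open>n + t\<close> is bounded by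
  some \<open>F t\<close>. The word \<open>e 1 \<dots> e n\<close> ends with a copy of \<open>e 1 \<dots> e (S u)\<close> for some \<open>u\<close>, and \<open>u\<close> says a lot
  about the past of \<open>n\<close>. The inequality \<open>Q (k + 1) > Q (Q (Q k) + 1) + 1\<close>, which passes from its initial
  range to all \<open>k\<close> by the block structure, shows that \<open>\<kappa>\<close> is either \<open>Q (u + 1)\<close> or \<open>Q (u + 1) + 1\<close>, and
  that the future reveals which (\<open>tied_breaks\<close>, \<open>synchronous\<close>). Hence \<open>n\<close> and \<open>m\<close>, with indices \<open>u\<close> and
  \<open>u'\<close>, can be moved forward together, to times with larger indices, as often as desired; the indices
  never coincide because the different symbols at \<open>n\<close> and \<open>m\<close> remain inside the two copies. Once both indices
  are large, the block structure leaves no choice: \<open>u\<close> and \<open>u'\<close> increase by one in each step and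
  \<open>Q (u + 1) = Q (u' + 1)\<close> throughout. When the larger index, say \<open>u'\<close>, reaches the end of its
  block, \<open>Q (u' + 1) = u'\<close>, whereas \<open>Q (u + 1) \<le> u < u'\<close> (\<open>no_twins\<close>).
\<close>

section \<open>Words, cutting times and the kneading map\<close>

definition agree :: "(nat \<Rightarrow> bool) \<Rightarrow> nat \<Rightarrow> nat \<Rightarrow> bool" where
  "agree e m L \<longleftrightarrow> (\<forall>y. 1 \<le> y \<and> y \<le> L \<longrightarrow> e (m + y) = e y)"

text \<open>
  The index \<open>k\<close> measures how closely the orbit returns to the turning point at time \<open>m\<close>: the orbit segments
  starting at times \<open>m\<close> and \<open>0\<close> are separated by the turning point for the first time after \<open>S k\<close> steps.
\<close>

definition breaks :: "(nat \<Rightarrow> bool) \<Rightarrow> (nat \<Rightarrow> nat) \<Rightarrow> nat \<Rightarrow> nat \<Rightarrow> bool" where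
  "breaks e S m k \<longleftrightarrow> agree e m (S k - 1) \<and> e (m + S k) \<noteq> e (S k)"

lemma agree_0 [simp]: "agree e 0 L"
  by (simp add: agree_def)

lemma agreeD: "agree e m L \<Longrightarrow> 1 \<le> y \<Longrightarrow> y \<le> L \<Longrightarrow> e (m + y) = e y"
  by (simp add: agree_def)

lemma agree_mono: "agree e m L \<Longrightarrow> L' \<le> L \<Longrightarrow> agree e m L'"
  by (auto simp: agree_def)

lemma agree_shift:
  assumes "agree e m (d + L)"
  shows "agree e (m + d) L \<longleftrightarrow> agree e d L"
proof -
  have "e (m + d + y) = e (d + y)" if "1 \<le> y" "y \<le> L" for y
    using agreeD[OF assms, of "d + y"] that by (simp add: add.assoc)
  then show ?thesis by (auto simp: agree_def)
qed

text \<open>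
  What the symbol sequence of the turning point of a tent map satisfies. The assumption on \<open>breaks\<close> for
  \<open>S k\<close> says that \<open>S (k + 1)\<close> is the first mismatch of \<open>e\<close> with its shift by \<open>S k\<close>; the last one says that
  every shift has a first mismatch, and that it occurs after \<open>S \<kappa>\<close> steps for some \<open>\<kappa>\<close>.
\<close>

locale kneading =
  fixes e :: "nat \<Rightarrow> bool" and S Q :: "nat \<Rightarrow> nat"
  assumes S_0: "S 0 = 1"
    and S_Suc: "S (Suc k) = S k + S (Q (Suc k))"
    and breaks_S: "breaks e S (S k) (Q (Suc k))"
    and ex_breaks: "m \<ge> 1 \<Longrightarrow> \<exists>k. breaks e S m k"
begin

lemma S_pos: "1 \<le> S k"
  by (induction k) (auto simp: S_0 S_Suc)

lemma strict_mono_S: "strict_mono S"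
  unfolding strict_mono_Suc_iff using S_pos S_Suc by (metis less_add_same_cancel1 less_eq_Suc_le One_nat_def)

lemma S_less_iff [simp]: "S i < S j \<longleftrightarrow> i < j"
  using strict_mono_S by (simp add: strict_mono_less)

lemma S_le_iff [simp]: "S i \<le> S j \<longleftrightarrow> i \<le> j"
  using strict_mono_S by (simp add: strict_mono_less_eq)

lemma less_S: "k < S k"
proof (induction k)
  case (Suc k)
  then show ?case using S_Suc[of k] S_pos[of "Q (Suc k)"] by linarith
qed (simp add: S_0)

lemma Q_le: "Q (Suc k) \<le> k"
proof -
  have "S (Q (Suc k)) < S (Suc k)" using S_Suc[of k] S_pos[of k] by simp
  then show ?thesis by (simp add: less_Suc_eq_le)
qed

lemma breaks_pos: "breaks e S m k \<Longrightarrow> m \<ge> 1"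
  by (cases m) (auto simp: breaks_def)

lemma breaks_agree_iff:
  assumes "breaks e S m k" shows "agree e m L \<longleftrightarrow> L < S k"
proof
  assume *: "agree e m L"
  show "L < S k"
  proof (rule ccontr)
    assume "\<not> L < S k"
    then have "e (m + S k) = e (S k)" using agreeD[OF *, of "S k"] S_pos by auto
    with assms show False by (simp add: breaks_def)
  qed
next
  assume "L < S k" then show "agree e m L" using assms agree_mono unfolding breaks_def by force
qed

lemma breaks_unique: "breaks e S m k \<Longrightarrow> breaks e S m l \<Longrightarrow> k = l"
  by (meson S_less_iff breaks_agree_iff linorder_neqE_nat order_less_irrefl)

text \<open>
  A first mismatch is a cutting time, so it cannot lie strictly between two consecutive cutting times.
\<close>

lemma agree_next:
  assumes "agree e m (S v)" shows "agree e m (S (Suc v) - 1)"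
proof (cases "m = 0")
  case False
  then obtain k where k: "breaks e S m k" using ex_breaks[of m] by auto
  then have "v < k" using assms breaks_agree_iff by simp
  then have "S (Suc v) \<le> S k" by simp
  then have "S (Suc v) - 1 < S k" using S_pos[of "Suc v"] by linarith
  with k show ?thesis using breaks_agree_iff by blast
qed simp

lemma agree_or_breaks:
  assumes "agree e m (S v)" shows "agree e m (S (Suc v)) \<or> breaks e S m (Suc v)"
proof (cases "e (m + S (Suc v)) = e (S (Suc v))")
  case True
  have "e (m + y) = e y" if "1 \<le> y" "y \<le> S (Suc v)" for y
    using agreeD[OF agree_next[OF assms], of y] that True by (cases "y = S (Suc v)") auto
  then show ?thesis by (simp add: agree_def)
next
  case False
  then show ?thesis using agree_next[OF assms] by (simp add: breaks_def)
qed

lemma breaks_shift: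
  assumes "agree e m (d + S k)"
  shows "breaks e S (m + d) k \<longleftrightarrow> breaks e S d k"
proof -
  have "agree e m (d + (S k - 1))" using assms agree_mono by force
  moreover have "e (m + d + S k) = e (d + S k)"
    using agreeD[OF assms, of "d + S k"] S_pos[of k] by (simp add: add.assoc)
  ultimately show ?thesis by (simp add: breaks_def agree_shift)
qed

text \<open>
  The last \<open>S u\<close> symbols up to time \<open>n\<close> repeat the initial word of that length, so that \<open>n\<close> inherits the past
  of \<open>S u\<close>. The case \<open>n0 = 0\<close>, in which \<open>n\<close> is itself a cutting time, is included since \<open>agree e 0 L\<close>
  always holds.
\<close>

definition suffix_index :: "nat \<Rightarrow> nat \<Rightarrow> bool" where
  "suffix_index n u \<longleftrightarrow> (\<exists>n0. n = n0 + S u \<and> agree e n0 (S u))"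

text \<open>
  If the repetition that started at \<open>n0\<close> survives the next cutting time, the future of \<open>n\<close> imitates that
  of \<open>S u\<close> until then.
\<close>

definition free :: "nat \<Rightarrow> nat \<Rightarrow> bool" where
  "free n u \<longleftrightarrow> (\<exists>n0. n = n0 + S u \<and> agree e n0 (S (Suc u)))"

text \<open>
  If the repetition fails exactly at the next cutting time, the future of \<open>n\<close> depends on the history of
  \<open>n0\<close>. Requiring \<open>n0\<close> to be free itself makes that history readable; \<open>suffix_index_cases\<close> below
  explains why this is no loss.
\<close>

definition tied :: "nat \<Rightarrow> nat \<Rightarrow> bool" where
  "tied n u \<longleftrightarrow> (\<exists>n0 i. n = n0 + S u \<and> breaks e S n0 (Suc u) \<and> free n0 i)"

lemma free_suffix_index: "free n u \<Longrightarrow> suffix_index n u"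
  unfolding free_def suffix_index_def using agree_mono by fastforce

lemma tied_suffix_index: "tied n u \<Longrightarrow> suffix_index n u"
  unfolding tied_def suffix_index_def using breaks_agree_iff by fastforce

lemma suffix_index_less: "suffix_index n u \<Longrightarrow> u < n"
  unfolding suffix_index_def using less_S[of u] by auto

text \<open>
  The symbol \<open>t\<close> steps in the past can be read off from \<open>u\<close> if it lies inside the repeated word. This is what
  keeps two indices apart when the pasts are known to differ.
\<close>

lemma suffix_index_symbol:
  assumes "suffix_index (n + t) u" "t < S u" shows "e n = e (S u - t)"
proof -
  from assms obtain n0 where n0: "n + t = n0 + S u" "agree e n0 (S u)" unfolding suffix_index_def by blast
  have "n = n0 + (S u - t)" using n0 assms by simp
  then show ?thesis using agreeD[OF n0(2), of "S u - t"] assms by simp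
qed

lemma free_breaks:
  assumes "free n u" shows "breaks e S n (Q (Suc u))"
proof -
  from assms obtain n0 where n0: "n = n0 + S u" "agree e n0 (S (Suc u))" unfolding free_def by blast
  then show ?thesis using breaks_shift[of n0 "S u" "Q (Suc u)"] breaks_S by (simp add: S_Suc)
qed

lemma free_next:
  assumes "free n u" shows "suffix_index (n + S (Q (Suc u))) (Suc u)"
proof -
  from assms obtain n0 where n0: "n = n0 + S u" "agree e n0 (S (Suc u))" unfolding free_def by blast
  then show ?thesis unfolding suffix_index_def by (intro exI[of _ n0]) (simp add: S_Suc)
qed

text \<open>
  At a time with index \<open>u + 1\<close> the future imitates that of the cutting time \<open>S (u + 1)\<close> strictly until the
  next cutting time, by \<open>agree_next\<close>, hence for fewer than \<open>S (Q (u + 2))\<close> symbols.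
\<close>

lemma suffix_index_agree:
  assumes "suffix_index n (Suc u)" "L < S (Q (Suc (Suc u)))" shows "agree e n L"
proof -
  from assms obtain n0 where n0: "n = n0 + S (Suc u)" "agree e n0 (S (Suc u))" unfolding suffix_index_def by blast
  have "agree e n0 (S (Suc u) + L)"
    using agree_next[OF n0(2)] assms(2) S_Suc[of "Suc u"] agree_mono by simp
  then have "agree e n L \<longleftrightarrow> agree e (S (Suc u)) L" using n0 agree_shift by simp
  then show ?thesis using breaks_agree_iff[OF breaks_S] assms(2) by simp
qed

lemma ex_S_le:
  assumes "n \<ge> 1" obtains k where "S k \<le> n" "n < S (Suc k)"
proof -
  define k where "k = (GREATEST k. S k \<le> n)"
  have b: "\<And>k. S k \<le> n \<Longrightarrow> k \<le> n" using less_S order.strict_trans2 by (meson less_imp_le)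
  have "S k \<le> n" unfolding k_def by (rule GreatestI_nat[of _ 0 n]) (use assms S_0 b in auto)
  moreover have "\<not> S (Suc k) \<le> n"
  proof
    assume "S (Suc k) \<le> n"
    then have "Suc k \<le> k" unfolding k_def by (rule Greatest_le_nat) (use b in auto)
    then show False by simp
  qed
  ultimately show ?thesis using that by simp
qed

text \<open>
  Greedy expansion: subtract the largest cutting time and continue with the remainder, which is smaller than
  the time for which the symbols after that cutting time repeat \<open>e\<close>.
\<close>

lemma ex_suffix_index: "n \<ge> 1 \<Longrightarrow> \<exists>u. suffix_index n u"
proof (induction n rule: less_induct)
  case (less n)
  obtain k where k: "S k \<le> n" "n < S (Suc k)" using ex_S_le[OF less.prems] .
  show ?case
  proof (cases "n = S k")
    case True
    then show ?thesis unfolding suffix_index_def by (intro exI[of _ k] exI[of _ 0]) simp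
  next
    case False
    define r where "r = n - S k"
    have r: "n = S k + r" "1 \<le> r" "r < n" "r < S (Q (Suc k))" using k False S_pos[of k] S_Suc[of k] by (auto simp: r_def)
    from less.IH[OF r(3,2)] obtain u n0 where u: "r = n0 + S u" "agree e n0 (S u)"
      unfolding suffix_index_def by blast
    have "agree e (S k) (n0 + S u)" using breaks_agree_iff[OF breaks_S] r(4) u(1) by simp
    then have "agree e (S k + n0) (S u)" using agree_shift u(2) by blast
    then show ?thesis unfolding suffix_index_def using r(1) u(1) by (metis add.assoc)
  qed
qed

end

section \<open>The separation inequality synchronises equal futures\<close>

text \<open>
  Since \<open>S l\<close> has return index \<open>Q (l + 1)\<close>, the inequality says that \<open>c\<close> is approached at time
  \<open>S (l + 1)\<close> by at least two levels more closely than at time \<open>S (Q (Q (l + 1)))\<close>.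
\<close>

locale separated_kneading = kneading +
  assumes sep: "1 \<le> Q (Suc l) \<Longrightarrow> Q (Suc (Q (Q (Suc l)))) + 1 < Q (Suc (Suc l))"
begin

text \<open>
  Let \<open>n0 = n - S u\<close> and \<open>p = n0 + S (u + 1) = n + S g\<close>. At \<open>p\<close> two deviations cancel, so the future of
  \<open>n\<close> still agrees with \<open>e\<close> there. As \<open>n0\<close> is free with some index \<open>i\<close>, the time \<open>p\<close> has index \<open>i + 1\<close>.
  By the separation inequality \<open>p\<close> returns much closer to \<open>c\<close> than \<open>S g\<close> does. Thus the next
  mismatch is that of \<open>S g\<close>, after \<open>S g + S (Q (g + 1)) = S (g + 1)\<close> steps.
\<close>

lemma tied_breaks:
  assumes "tied n u"
  defines "g \<equiv> Q (Suc u)"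
  shows "breaks e S n (Suc g)" "free (n + S (Suc g)) (Q (Suc g))"
    "\<exists>i. Suc u = Q (Suc i) \<and> suffix_index (n + S g) (Suc i)"
proof -
  from assms(1) obtain n0 i n1 where n0: "n = n0 + S u" "breaks e S n0 (Suc u)"
    and n1: "n0 = n1 + S i" "agree e n1 (S (Suc i))" unfolding tied_def free_def by blast
  have fr: "free n0 i" using n1 by (auto simp: free_def)
  have Qi: "Suc u = Q (Suc i)" using free_breaks[OF fr] n0(2) breaks_unique by blast
  define p where "p = n0 + S (Suc u)"
  have pv: "suffix_index p (Suc i)" using free_next[OF fr] by (simp add: p_def Qi)
  have p: "p = n + S g" using n0 by (simp add: p_def S_Suc g_def)
  show "\<exists>i. Suc u = Q (Suc i) \<and> suffix_index (n + S g) (Suc i)" using Qi pv p by blast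
  define h where "h = Q (Suc g)"
  have "h + 1 < Q (Suc (Suc i))" using sep[of i] Qi by (simp add: h_def g_def)
  then have pa: "agree e p (S (Suc h))" using suffix_index_agree[OF pv] by simp
  have pa': "agree e p (S h)" using agree_mono[OF pa] by simp
  show fp: "free (n + S (Suc g)) (Q (Suc g))"
    unfolding free_def using pa p by (intro exI[of _ p]) (simp add: S_Suc h_def)
  \<comment> \<open>\<open>e p \<noteq> e (S (u + 1))\<close> because \<open>n0\<close> breaks there, and \<open>e (S (u + 1)) \<noteq> e (S g)\<close> by the definition of \<open>Q\<close>.\<close>
  have eg: "e (n + S g) = e (S g)"
  proof -
    have "e p \<noteq> e (S (Suc u))" using n0(2) by (simp add: breaks_def p_def)
    moreover have "e (S (Suc u)) \<noteq> e (S g)" using breaks_S[of u] S_Suc[of u] by (simp add: breaks_def g_def)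
    ultimately show ?thesis using p by simp
  qed
  have b: "breaks e S (S g) h" unfolding h_def by (rule breaks_S)
  have low: "e (n + y) = e y" if "1 \<le> y" "y < S g" for y
  proof -
    have "e (n0 + (S u + y)) = e (S u + y)"
      using n0(2) that S_Suc[of u] unfolding breaks_def g_def[symmetric] by (intro agreeD) auto
    also have "\<dots> = e y"
      using breaks_S[of u] that unfolding g_def[symmetric] breaks_def by (intro agreeD) auto
    finally show ?thesis using n0 by (simp add: add.assoc)
  qed
  have "agree e n (S g + S h - 1)"
    unfolding agree_def
  proof (intro allI impI)
    fix y assume y: "1 \<le> y \<and> y \<le> S g + S h - 1"
    consider "y < S g" | "y = S g" | "y > S g" by linarith
    then show "e (n + y) = e y"
    proof cases
      case 3
      define z where "z = y - S g"
      have z: "y = S g + z" "1 \<le> z" "z < S h" using 3 y by (auto simp: z_def)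
      have "e (p + z) = e z" using agreeD[OF pa'] z by simp
      moreover have "e (S g + z) = e z" using b z unfolding breaks_def by (intro agreeD) auto
      ultimately show ?thesis using z p by (simp add: add.assoc)
    qed (use low eg y in auto)
  qed
  moreover have "e (n + S (Suc g)) \<noteq> e (S (Suc g))"
  proof -
    have "e (p + S h) = e (S h)" using agreeD[OF pa'] S_pos by simp
    moreover have "e (S g + S h) \<noteq> e (S h)" using b by (simp add: breaks_def)
    ultimately show ?thesis using p by (simp add: S_Suc h_def add.assoc)
  qed
  ultimately show "breaks e S n (Suc g)" by (simp add: breaks_def S_Suc h_def)
qed

definition free_or_tied :: "nat \<Rightarrow> nat \<Rightarrow> bool" where
  "free_or_tied n u \<longleftrightarrow> free n u \<or> tied n u"

lemma free_or_tied_suffix_index: "free_or_tied n u \<Longrightarrow> suffix_index n u"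
  using free_suffix_index tied_suffix_index by (auto simp: free_or_tied_def)

text \<open>
  If the repetition fails at the next cutting time, but \<open>n0\<close> is itself tied, then \<open>n\<close> is the time \<open>p\<close> of
  \<open>tied_breaks\<close> for an earlier return. It therefore has another index \<open>w\<close> that is larger, and two
  applications of \<open>Q\<close> lead from \<open>w\<close> back to \<open>v\<close>. The second assumption is an induction hypothesis.
\<close>

lemma suffix_index_cases_aux:
  assumes "suffix_index n v" and "\<And>m. 1 \<le> m \<Longrightarrow> m < n \<Longrightarrow> \<exists>u. free_or_tied m u"
  shows "free_or_tied n v \<or> (\<exists>w>v. suffix_index n w \<and> 1 \<le> Q w \<and> v = Q (Q w))"
proof -
  from assms(1) obtain n0 where n0: "n = n0 + S v" "agree e n0 (S v)" unfolding suffix_index_def by blast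
  from agree_or_breaks[OF n0(2)] show ?thesis
  proof
    assume "agree e n0 (S (Suc v))"
    then show ?thesis using n0 by (auto simp: free_or_tied_def free_def)
  next
    assume br: "breaks e S n0 (Suc v)"
    have "1 \<le> n0" "n0 < n" using breaks_pos[OF br] n0 S_pos[of v] by auto
    with assms(2) obtain i where "free_or_tied n0 i" by blast
    then consider "free n0 i" | "tied n0 i" by (auto simp: free_or_tied_def)
    then show ?thesis
    proof cases
      case 1
      then show ?thesis using n0 br by (auto simp: free_or_tied_def tied_def)
    next
      case 2
      from tied_breaks[OF 2] obtain l where l: "breaks e S n0 (Suc (Q (Suc i)))" "Suc i = Q (Suc l)"
        "suffix_index (n0 + S (Q (Suc i))) (Suc l)" by blast
      have v: "v = Q (Suc i)" using breaks_unique[OF br l(1)] by simp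
      have "v \<le> i" "Suc i \<le> l" using Q_le[of i] v Q_le[of l] l(2) by auto
      then show ?thesis using l v n0 by (intro disjI2 exI[of _ "Suc l"]) auto
    qed
  qed
qed

lemma free_or_tied_above_aux:
  assumes "\<And>m. 1 \<le> m \<Longrightarrow> m < n \<Longrightarrow> \<exists>u. free_or_tied m u"
  shows "suffix_index n v \<Longrightarrow> \<exists>u\<ge>v. free_or_tied n u"
proof (induction "n - v" arbitrary: v rule: less_induct)
  case less
  from suffix_index_cases_aux[OF less.prems assms] consider "free_or_tied n v" | w where "w > v" "suffix_index n w" by blast
  then show ?case
  proof cases
    case 2
    then have "n - w < n - v" using suffix_index_less[OF less.prems] by simp
    with less.hyps[OF this 2(2)] 2(1) show ?thesis by (meson less_imp_le order_trans)
  qed blast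
qed

lemma ex_free_or_tied: "n \<ge> 1 \<Longrightarrow> \<exists>u. free_or_tied n u"
proof (induction n rule: less_induct)
  case (less n)
  obtain v where "suffix_index n v" using ex_suffix_index[OF less.prems] by blast
  with free_or_tied_above_aux[of n v] less.IH show ?case by blast
qed

lemma free_or_tied_above: "suffix_index n v \<Longrightarrow> \<exists>u\<ge>v. free_or_tied n u"
  by (rule free_or_tied_above_aux) (use ex_free_or_tied in auto)

lemma suffix_index_cases: "suffix_index n v \<Longrightarrow> free_or_tied n v \<or> (\<exists>w>v. suffix_index n w \<and> 1 \<le> Q w \<and> v = Q (Q w))"
  by (rule suffix_index_cases_aux) (use ex_free_or_tied in auto)

text \<open>
  If \<open>q\<close> is tied and \<open>q'\<close> is free with the same \<open>\<kappa>\<close>, then after \<open>S \<kappa>\<close> further steps \<open>q\<close> arrives at a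
  time with return index \<open>r = Q (Q \<kappa> + 1)\<close>, but \<open>q'\<close> at one with a return index of at least
  \<open>Q (u' + 2)\<close>, and that is larger than \<open>r + 1\<close> by the separation inequality.
\<close>

lemma not_tied_free:
  assumes q: "tied q u" and q': "free q' u'" and k: "breaks e S q \<kappa>" and k': "breaks e S q' \<kappa>"
    and ag: "\<And>y. 1 \<le> y \<Longrightarrow> y \<le> 2 * S \<kappa> \<Longrightarrow> e (q + y) = e (q' + y)"
  shows False
proof -
  note t = tied_breaks[OF q]
  have k1: "\<kappa> = Suc (Q (Suc u))" using breaks_unique[OF k t(1)] .
  have k2: "\<kappa> = Q (Suc u')" using breaks_unique[OF k' free_breaks[OF q']] .
  define r where "r = Q (Suc (Q \<kappa>))"
  have b: "breaks e S (q + S \<kappa>) r" using free_breaks[OF t(2)] by (simp add: r_def k1)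
  have "r + 1 < Q (Suc (Suc u'))" using sep[of u'] k1 k2 by (simp add: r_def)
  then have "agree e (q' + S \<kappa>) (S r)" using suffix_index_agree[OF free_next[OF q']] k2 by simp
  then have "e (q' + S \<kappa> + S r) = e (S r)" using agreeD S_pos by blast
  moreover have "e (q + S \<kappa> + S r) \<noteq> e (S r)" using b by (simp add: breaks_def)
  moreover have "S r \<le> S \<kappa>"
  proof -
    have "r \<le> Q \<kappa>" unfolding r_def by (rule Q_le)
    also have "Q \<kappa> \<le> \<kappa>" using Q_le[of "Q (Suc u)"] k1 by simp
    finally show ?thesis by simp
  qed
  ultimately show False using ag[of "S \<kappa> + S r"] S_pos[of r] by (simp add: add.assoc)
qed

lemma breaks_cong:
  assumes "breaks e S q \<kappa>" "\<And>y. 1 \<le> y \<Longrightarrow> y \<le> S \<kappa> \<Longrightarrow> e (q + y) = e (q' + y)"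
  shows "breaks e S q' \<kappa>"
  using assms S_pos[of \<kappa>] unfolding breaks_def agree_def by auto

lemma synchronous:
  assumes q: "free_or_tied q u" and q': "free_or_tied q' u'" and k: "breaks e S q \<kappa>"
    and ag: "\<And>y. 1 \<le> y \<Longrightarrow> y \<le> 2 * S \<kappa> \<Longrightarrow> e (q + y) = e (q' + y)"
  obtains "free q u" "free q' u'" "\<kappa> = Q (Suc u)" "\<kappa> = Q (Suc u')"
  | "tied q u" "tied q' u'" "\<kappa> = Suc (Q (Suc u))" "\<kappa> = Suc (Q (Suc u'))"
proof -
  have k': "breaks e S q' \<kappa>" using breaks_cong[OF k] ag by simp
  have "\<not> (tied q u \<and> free q' u')" using not_tied_free[OF _ _ k k' ag] by blast
  moreover have "\<not> (tied q' u' \<and> free q u)" using not_tied_free[OF _ _ k' k] ag by metis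
  ultimately consider "free q u" "free q' u'" | "tied q u" "tied q' u'" using q q' by (auto simp: free_or_tied_def)
  then show ?thesis
  proof cases
    case 1
    then show ?thesis using that(1) free_breaks breaks_unique k k' by metis
  next
    case 2
    then show ?thesis using that(2) tied_breaks(1) breaks_unique k k' by metis
  qed
qed

text \<open>
  Two free times proceed to the next mismatch, after which the indices have grown by one. Two tied times proceed
  to the times \<open>p\<close> of \<open>tied_breaks\<close>, which are equally far away because \<open>Q (u + 1) = Q (u' + 1)\<close>. The
  bounds \<open>S u + d \<le> S v\<close> say that the repeated words grow by at least the elapsed time \<open>d\<close>, so
  whatever lay inside them in the past remains inside.
\<close>

lemma synchronous_step:
  assumes q: "free_or_tied q u" and q': "free_or_tied q' u'" and k: "breaks e S q \<kappa>"
    and ag: "\<And>y. 1 \<le> y \<Longrightarrow> y \<le> 2 * S \<kappa> \<Longrightarrow> e (q + y) = e (q' + y)"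
  obtains d v v' where "d \<le> S \<kappa>" "free_or_tied (q + d) v" "free_or_tied (q' + d) v'" "u < v" "u' < v'"
    "S u + d \<le> S v" "S u' + d \<le> S v'"
proof -
  have "\<exists>d v v'. d \<le> S \<kappa> \<and> suffix_index (q + d) v \<and> suffix_index (q' + d) v' \<and> u < v \<and> u' < v' \<and>
    S u + d \<le> S v \<and> S u' + d \<le> S v'"
  proof -
    consider "free q u" "free q' u'" "\<kappa> = Q (Suc u)" "\<kappa> = Q (Suc u')"
      | "tied q u" "tied q' u'" "\<kappa> = Suc (Q (Suc u))" "\<kappa> = Suc (Q (Suc u'))"
      using synchronous[OF q q' k ag] by metis
    then show ?thesis
    proof cases
      case 1
      then show ?thesis
        using free_next[OF 1(1)] free_next[OF 1(2)] S_Suc[of u] S_Suc[of u']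
        by (intro exI[of _ "S \<kappa>"] exI[of _ "Suc u"] exI[of _ "Suc u'"]) simp
    next
      case 2
      obtain i where i: "Suc u = Q (Suc i)" "suffix_index (q + S (Q (Suc u))) (Suc i)" using tied_breaks(3)[OF 2(1)] by blast
      obtain i' where i': "Suc u' = Q (Suc i')" "suffix_index (q' + S (Q (Suc u'))) (Suc i')" using tied_breaks(3)[OF 2(2)] by blast
      have "Suc u \<le> i" "Suc u' \<le> i'" using i i' Q_le by metis+
      moreover have "S u + S (Q (Suc u)) \<le> S (Suc i)" "S u' + S (Q (Suc u')) \<le> S (Suc i')"
        using i i' S_Suc by (metis le_add2)+
      ultimately show ?thesis using i i' 2
        by (intro exI[of _ "S (Q (Suc u))"] exI[of _ "Suc i"] exI[of _ "Suc i'"]) auto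
    qed
  qed
  then obtain d v v' where *: "d \<le> S \<kappa>" "suffix_index (q + d) v" "suffix_index (q' + d) v'" "u < v" "u' < v'"
    "S u + d \<le> S v" "S u' + d \<le> S v'" by blast
  obtain w where w: "w \<ge> v" "free_or_tied (q + d) w" using free_or_tied_above[OF *(2)] by blast
  obtain w' where w': "w' \<ge> v'" "free_or_tied (q' + d) w'" using free_or_tied_above[OF *(3)] by blast
  show ?thesis
    using * w w' S_le_iff[of v w] S_le_iff[of v' w'] by (intro that[of d w w']) (auto intro: order_trans)
qed

end


section \<open>The block structure of the kneading map\<close>

text \<open>
  For \<open>i \<ge> 3\<close> the values of \<open>Q\<close> on the block from \<open>b i\<close> to \<open>b (i + 1) - 1\<close> are \<open>b i - 1\<close>,
  \<open>b (i - 1) - 1\<close>, \<open>\<dots>\<close>, \<open>b 3 - 1\<close>, \<open>Q (b 2)\<close>, \<open>Q (b 1)\<close>. The separation inequality is assumed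
  on an initial range only; the block structure extends it (\<open>sep_all\<close>).
\<close>

locale block_kneading = kneading +
  fixes b :: "nat \<Rightarrow> nat"
  assumes b_1: "1 \<le> b 1"
    and b_Suc: "1 \<le> i \<Longrightarrow> b (Suc i) = b i + i"
    and Q_b: "3 \<le> i \<Longrightarrow> Q (b i) = b i - 1"
    and Q_shift: "2 \<le> i \<Longrightarrow> 1 \<le> j \<Longrightarrow> j < i \<Longrightarrow> Q (b i + j) = Q (b (i - 1) + j - 1)"
    and sep_initial: "1 \<le> l \<Longrightarrow> l \<le> b 2 + 2 \<Longrightarrow> 1 \<le> Q l \<Longrightarrow> Q (Q (Q l) + 1) + 1 < Q (l + 1)"
begin

lemma Q_less: "1 \<le> l \<Longrightarrow> Q l < l"
  using Q_le[of "l - 1"] by simp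

lemma b_2: "b 2 = b 1 + 1" and b_3: "b 3 = b 1 + 3"
  using b_Suc[of 1] b_Suc[of 2] by (simp_all add: numeral_2_eq_2 numeral_3_eq_3)

lemma b_mono: "1 \<le> i \<Longrightarrow> i \<le> j \<Longrightarrow> b i \<le> b j"
proof (rotate_tac, induction j rule: nat_induct_at_least)
  case (Suc j)
  then show ?case using b_Suc[of j] by simp
qed simp

lemma b_strict_mono: "1 \<le> i \<Longrightarrow> i < j \<Longrightarrow> b i < b j"
  using b_mono[of "Suc i" j] b_Suc[of i] by simp

lemma b_ge: "1 \<le> i \<Longrightarrow> i \<le> b i"
  by (induction i rule: nat_induct_at_least) (use b_1 b_Suc in auto)

lemma Q_block: "j < i \<Longrightarrow> Q (b i + j) = Q (b (i - j))"
proof (induction j arbitrary: i)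
  case (Suc j)
  then show ?case using Q_shift[of i "Suc j"] Suc.IH[of "i - 1"] by simp
qed simp

lemma block_cases:
  assumes "b 1 \<le> l" obtains i j where "1 \<le> i" "j < i" "l = b i + j"
proof -
  define i where "i = (GREATEST i. 1 \<le> i \<and> b i \<le> l)"
  have bd: "i \<le> l" if "1 \<le> i \<and> b i \<le> l" for i using b_ge[of i] that by simp
  have i: "1 \<le> i \<and> b i \<le> l" unfolding i_def by (rule GreatestI_nat[of _ 1 l]) (use assms bd in auto)
  have "\<not> (1 \<le> Suc i \<and> b (Suc i) \<le> l)"
  proof
    assume "1 \<le> Suc i \<and> b (Suc i) \<le> l"
    then have "Suc i \<le> i" unfolding i_def by (rule Greatest_le_nat) (use bd in auto)
    then show False by simp
  qed
  then have "l < b i + i" using b_Suc i by simp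
  then show ?thesis using i that[of i "l - b i"] by simp
qed

lemma b_last: "2 \<le> i \<Longrightarrow> b i - 1 = b (i - 1) + (i - 2)"
  using b_Suc[of "i - 1"] by simp

lemma QQ_b: "3 \<le> i \<Longrightarrow> Q (Q (b i)) = Q (b 1)"
  using Q_block[of "i - 2" "i - 1"] Q_b b_last[of i] by (simp add: numeral_eq_Suc)

lemma Q_b_1: "1 \<le> Q (b 1)"
proof -
  have "2 \<le> Q (b 2)" using sep_initial[of "b 3"] Q_b[of 3] Q_block[of 1 3] b_1 b_2 b_3 by simp
  then show ?thesis using sep_initial[of "b 2"] Q_block[of 1 2] b_2 by simp
qed

lemma Q_small: "Q (Q (b 1) + 1) + 1 < b 3 - 1"
  using Q_less[of "b 1"] Q_less[of "Q (b 1) + 1"] b_1 b_3 by simp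

text \<open>
  Neighbours inside a block have the values \<open>Q (b m)\<close> and \<open>Q (b (m - 1))\<close>. For \<open>m \<le> 3\<close> this pair occurs in the
  initial range; for \<open>m \<ge> 4\<close>, and across the end of a block, the right hand side is large and
  the left hand side depends only on \<open>Q (b 1)\<close>.
\<close>

lemma sep_all:
  assumes "1 \<le> Q (Suc l)" shows "Q (Suc (Q (Q (Suc l)))) + 1 < Q (Suc (Suc l))"
proof (cases "Suc l \<le> b 2 + 2")
  case True
  then show ?thesis using sep_initial[of "Suc l"] assms by simp
next
  case False
  then have l: "b 3 \<le> Suc l" using b_2 b_3 by simp
  then obtain i j where ij: "1 \<le> i" "j < i" "Suc l = b i + j" using block_cases[of "Suc l"] b_3 by auto
  have i3: "3 \<le> i"
  proof (rule ccontr)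
    assume "\<not> 3 \<le> i"
    then have "b (Suc i) \<le> b 3" using b_mono ij by simp
    then show False using b_Suc[of i] ij l by simp
  qed
  have Qm: "Q (Suc l) = Q (b (i - j))" using Q_block ij by simp
  show ?thesis
  proof (cases "Suc j < i")
    case True
    then have Qn: "Q (Suc (Suc l)) = Q (b (i - j - 1))" using Q_block[of "Suc j" i] ij by simp
    define m where "m = i - j"
    have "m \<ge> 2" using True by (simp add: m_def)
    then consider "m = 2" | "m = 3" | "m \<ge> 4" by linarith
    then show ?thesis
    proof cases
      case 1
      then show ?thesis using Qm Qn sep_initial[of "b 2"] Q_block[of 1 2] b_2 assms by (simp add: m_def)
    next
      case 2
      then show ?thesis using Qm Qn sep_initial[of "b 3"] Q_block[of 1 3] b_2 b_3 assms by (simp add: m_def)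
    next
      case 3
      then have *: "Q (Q (b m)) = Q (b 1)" "Q (b (m - 1)) = b (m - 1) - 1" "b 3 \<le> b (m - 1)"
        using QQ_b Q_b b_mono by auto
      have "b 3 - 1 \<le> b (m - 1) - 1" using *(3) by simp
      then have "Q (Q (b 1) + 1) + 1 < b (m - 1) - 1" using Q_small by linarith
      then show ?thesis using Qm Qn * by (simp add: m_def)
    qed
  next
    case False
    then have j: "j = i - 1" using ij by simp
    then have "Q (Suc l) = Q (b 1)" using Qm ij by simp
    moreover have "Suc (Suc l) = b (Suc i)" using ij j b_Suc by simp
    moreover have "Q (b (Suc i)) = b (Suc i) - 1" "b 3 \<le> b (Suc i)" using Q_b i3 b_mono by auto
    moreover have "Q (Suc (Q (Q (b 1)))) \<le> Q (Q (b 1))" by (rule Q_le)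
    moreover have "Q (Q (b 1)) < Q (b 1)" using Q_less Q_b_1 by simp
    moreover have "Q (b 1) < b 1" using Q_less b_1 by simp
    ultimately show ?thesis using b_3 by simp
  qed
qed

sublocale separated_kneading
  by unfold_locales (rule sep_all)

lemma Q_cases:
  assumes "b 3 \<le> w"
  obtains i j where "3 \<le> i" "j < i" "w = b i + j"
proof -
  obtain i j where ij: "1 \<le> i" "j < i" "w = b i + j" using block_cases[of w] assms b_3 by auto
  moreover have "3 \<le> i"
  proof (rule ccontr)
    assume "\<not> 3 \<le> i"
    then have "b (Suc i) \<le> b 3" using b_mono ij by simp
    then show False using b_Suc[of i] ij assms by simp
  qed
  ultimately show ?thesis using that by blast
qed

text \<open>
  A large value \<open>Q w = b m - 1\<close> is the last position of a block, where \<open>Q\<close> takes the small value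
  \<open>Q (b 1)\<close>. So the second alternative of \<open>suffix_index_cases\<close> does not occur for large indices.
\<close>

lemma QQ_small:
  assumes "1 \<le> w" "1 \<le> Q w" shows "Q (Q w) < b 3"
proof (cases "w < b 3")
  case True
  then show ?thesis using Q_less[OF assms(1)] Q_less[OF assms(2)] by simp
next
  case False
  then obtain i j where ij: "3 \<le> i" "j < i" "w = b i + j" using Q_cases[of w] by auto
  define m where "m = i - j"
  have Qm: "Q w = Q (b m)" using Q_block ij by (simp add: m_def)
  show ?thesis
  proof (cases "m \<ge> 3")
    case True
    then show ?thesis using Qm QQ_b Q_less[of "b 1"] b_1 b_3 by simp
  next
    case False
    moreover have "1 \<le> m" using ij by (simp add: m_def)
    ultimately have "b m \<le> b 2" "1 \<le> b m" using b_mono[of m 2] b_mono[of 1 m] b_1 by auto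
    then show ?thesis using Qm Q_less[of "b m"] Q_less[of "Q w"] assms b_2 b_3 by simp
  qed
qed

lemma Q_large:
  assumes "1 \<le> w" "b 3 \<le> Q w"
  obtains M where "4 \<le> M" "Q w = b M - 1" "Q (Suc w) = b (M - 1) - 1"
proof -
  have "b 3 \<le> w" using assms Q_less[of w] by simp
  then obtain i j where ij: "3 \<le> i" "j < i" "w = b i + j" using Q_cases[of w] by auto
  define m where "m = i - j"
  have Qm: "Q w = Q (b m)" using Q_block ij by (simp add: m_def)
  have m1: "1 \<le> m" using ij by (simp add: m_def)
  have "4 \<le> m"
  proof (rule ccontr)
    assume "\<not> 4 \<le> m"
    then have "b m \<le> b 3" "1 \<le> b m" using b_mono[of m 3] b_mono[of 1 m] b_1 m1 by auto
    then show False using Qm Q_less[of "b m"] assms by simp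
  qed
  moreover have "Q (Suc w) = Q (b (m - 1))" using Q_block[of "Suc j" i] ij \<open>4 \<le> m\<close> by (simp add: m_def)
  ultimately show ?thesis using Qm Q_b by (intro that[of m]) auto
qed

lemma free_or_tied_of_large:
  assumes "suffix_index n v" "b 3 \<le> v" shows "free_or_tied n v"
proof (rule ccontr)
  assume "\<not> free_or_tied n v"
  then obtain w where "w > v" "1 \<le> Q w" "v = Q (Q w)" using suffix_index_cases[OF assms(1)] by blast
  then show False using QQ_small[of w] assms(2) by simp
qed

text \<open>
  Suppose that both times are tied. Then \<open>u + 1\<close> and \<open>u' + 1\<close> are large values \<open>Q (i + 1)\<close> and
  \<open>Q (i' + 1)\<close> of the kneading map. They are determined by the values \<open>Q (i + 2)\<close> and \<open>Q (i' + 2)\<close> that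
  follow them, and those coincide because the times with indices \<open>i + 1\<close> and \<open>i' + 1\<close> are
  synchronous, too. So \<open>u = u'\<close>.
\<close>

lemma large_both_free:
  assumes q: "free_or_tied q u" and q': "free_or_tied q' u'" and large: "b 3 \<le> u" "b 3 \<le> u'" and ne: "u \<noteq> u'"
    and k: "breaks e S q \<kappa>" and k2: "breaks e S (q + S (\<kappa> - 1)) \<mu>"
    and ag: "\<And>y. 1 \<le> y \<Longrightarrow> y \<le> 2 * (S \<kappa> + S \<mu>) \<Longrightarrow> e (q + y) = e (q' + y)"
  shows "free q u \<and> free q' u' \<and> Q (Suc u) = \<kappa> \<and> Q (Suc u') = \<kappa>"
proof -
  have ag1: "e (q + y) = e (q' + y)" if "1 \<le> y" "y \<le> 2 * S \<kappa>" for y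
    using ag[of y] that by simp
  show ?thesis
  proof (rule synchronous[OF q q' k ag1])
    assume t: "tied q u" "tied q' u'" and k: "\<kappa> = Suc (Q (Suc u))" "\<kappa> = Suc (Q (Suc u'))"
    obtain i where i: "Suc u = Q (Suc i)" "suffix_index (q + S (Q (Suc u))) (Suc i)" using tied_breaks(3)[OF t(1)] by blast
    obtain i' where i': "Suc u' = Q (Suc i')" "suffix_index (q' + S (Q (Suc u'))) (Suc i')" using tied_breaks(3)[OF t(2)] by blast
    have "Suc u \<le> i" "Suc u' \<le> i'" using i i' Q_le by metis+
    then have g: "free_or_tied (q + S (Q (Suc u))) (Suc i)" "free_or_tied (q' + S (Q (Suc u))) (Suc i')"
      using free_or_tied_of_large i(2) i'(2) large k by auto
    have br: "breaks e S (q + S (Q (Suc u))) \<mu>" using k2 k by simp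
    have le: "S (Q (Suc u)) \<le> S \<kappa>" using k by simp
    have ag2: "e (q + S (Q (Suc u)) + y) = e (q' + S (Q (Suc u)) + y)" if "1 \<le> y" "y \<le> 2 * S \<mu>" for y
      using ag[of "S (Q (Suc u)) + y"] that le by (simp add: add.assoc)
    have QQ: "Q (Suc (Suc i)) = Q (Suc (Suc i'))"
      by (rule synchronous[OF g br ag2]) auto
    obtain M where M: "4 \<le> M" "Q (Suc i) = b M - 1" "Q (Suc (Suc i)) = b (M - 1) - 1"
      using Q_large[of "Suc i"] i large by auto
    obtain M' where M': "4 \<le> M'" "Q (Suc i') = b M' - 1" "Q (Suc (Suc i')) = b (M' - 1) - 1"
      using Q_large[of "Suc i'"] i' large by auto
    have "1 \<le> b (M - 1)" "1 \<le> b (M' - 1)" using b_mono[of 1 "M - 1"] b_mono[of 1 "M' - 1"] b_1 M(1) M'(1) by linarith+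
    then have "b (M - 1) = b (M' - 1)" using QQ M M' by linarith
    then have "M - 1 = M' - 1"
      using b_strict_mono[of "M - 1" "M' - 1"] b_strict_mono[of "M' - 1" "M - 1"] M M' by linarith
    then have "M = M'" using M M' by simp
    then show ?thesis using M M' i i' ne by simp
  qed auto
qed

section \<open>Twins cannot have long equal futures\<close>

text \<open>
  Two times with different symbols whose futures agree for \<open>N\<close> steps. The function \<open>F\<close> keeps the orbit away
  from the turning point at each time \<open>t\<close> by a distance that is independent of \<open>N\<close>.
\<close>

definition twins :: "(nat \<Rightarrow> nat) \<Rightarrow> nat \<Rightarrow> nat \<Rightarrow> nat \<Rightarrow> bool" where
  "twins F N n m \<longleftrightarrow> 1 \<le> n \<and> 1 \<le> m \<and> e n \<noteq> e m \<and> (\<forall>y. 1 \<le> y \<and> y \<le> N \<longrightarrow> e (n + y) = e (m + y)) \<and>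
     (\<forall>t\<le>N. \<forall>\<kappa>. breaks e S (n + t) \<kappa> \<or> breaks e S (m + t) \<kappa> \<longrightarrow> \<kappa> \<le> F t)"

lemma twins_mono: "twins F N n m \<Longrightarrow> N' \<le> N \<Longrightarrow> twins F N' n m"
  by (auto simp: twins_def)

lemma twins_sym: "twins F N n m \<Longrightarrow> twins F N m n"
  by (auto simp: twins_def)

text \<open>
  Twins that have been moved forward by \<open>t\<close>. The conditions \<open>t < S u\<close> and \<open>t < S u'\<close> say that the
  original times \<open>n\<close> and \<open>m\<close> lie inside the repeated words.
\<close>

definition stage :: "(nat \<Rightarrow> nat) \<Rightarrow> nat \<Rightarrow> nat \<Rightarrow> nat \<Rightarrow> nat \<Rightarrow> nat \<Rightarrow> nat \<Rightarrow> nat \<Rightarrow> bool" where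
  "stage F N n m t u u' r \<longleftrightarrow> twins F N n m \<and> free_or_tied (n + t) u \<and> free_or_tied (m + t) u' \<and>
     t < S u \<and> t < S u' \<and> r \<le> u \<and> r \<le> u'"

lemma stage_ne: "stage F N n m t u u' r \<Longrightarrow> u \<noteq> u'"
  using suffix_index_symbol free_or_tied_suffix_index unfolding stage_def twins_def by metis

lemma F_bound: "t \<le> T \<Longrightarrow> (F :: nat \<Rightarrow> nat) t \<le> Max (F ` {..T})"
  by simp

text \<open>
  Iteration of \<open>synchronous_step\<close>. The bound \<open>T\<close> on the elapsed time must not depend on \<open>N\<close>, or the equal
  futures might be used up; \<open>F\<close> provides it, since a step takes at most \<open>S \<kappa>\<close> with \<open>\<kappa> \<le> F t\<close>.
\<close>

lemma ex_stage: "(\<And>N. \<exists>n m. twins F N n m) \<Longrightarrow> \<exists>T. \<forall>N. \<exists>n m t u u'. t \<le> T \<and> stage F N n m t u u' r"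
proof (induction r)
  case 0
  have "\<exists>n m u u'. stage F N n m 0 u u' 0" for N
  proof -
    obtain n m where nm: "twins F N n m" using 0 by blast
    then obtain u u' where "free_or_tied n u" "free_or_tied m u'" using ex_free_or_tied unfolding twins_def by metis
    then have "stage F N n m 0 u u' 0" using nm S_pos by (auto simp: stage_def Suc_le_eq)
    then show ?thesis by blast
  qed
  then show ?case by (meson le_refl)
next
  case (Suc r)
  then obtain T where T: "\<And>N. \<exists>n m t u u'. t \<le> T \<and> stage F N n m t u u' r" by blast
  define K where "K = Max (F ` {..T})"
  have "\<exists>n m t u u'. t \<le> T + S K \<and> stage F N n m t u u' (Suc r)" for N
  proof -
    \<comment> \<open>The elapsed time and the future inspected by one step, on top of the \<open>N\<close> symbols to be kept.\<close>
    define N' where "N' = N + T + 2 * S K"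
    obtain n m t u u' where t: "t \<le> T" and st: "stage F N' n m t u u' r" using T by blast
    then have tw: "twins F N' n m" and g: "free_or_tied (n + t) u" "free_or_tied (m + t) u'" by (auto simp: stage_def)
    obtain \<kappa> where k: "breaks e S (n + t) \<kappa>" using ex_breaks[of "n + t"] tw by (auto simp: twins_def)
    have "\<kappa> \<le> F t" using tw k t by (auto simp: twins_def N'_def)
    then have "\<kappa> \<le> K" using F_bound[OF t, of F] by (simp add: K_def)
    then have Sk: "S \<kappa> \<le> S K" by simp
    have "e (n + t + y) = e (m + t + y)" if "1 \<le> y" "y \<le> 2 * S \<kappa>" for y
    proof -
      have "t + y \<le> N'" using that t Sk unfolding N'_def by linarith
      then show ?thesis using tw that by (simp add: twins_def add.assoc)
    qed
    then obtain d v v' where d: "d \<le> S \<kappa>" "free_or_tied (n + t + d) v" "free_or_tied (m + t + d) v'" "u < v" "u' < v'"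
      "S u + d \<le> S v" "S u' + d \<le> S v'" using synchronous_step[OF g k] by metis
    then have "stage F N n m (t + d) v v' (Suc r)"
      using st twins_mono[OF tw, of N] by (auto simp: stage_def add.assoc N'_def)
    moreover have "t + d \<le> T + S K" using t d(1) Sk by linarith
    ultimately show ?thesis by blast
  qed
  then show ?case by blast
qed

text \<open>
  A stage with large indices in which the larger one is at most \<open>R\<close> steps away from the end of its block.
\<close>

definition run :: "(nat \<Rightarrow> nat) \<Rightarrow> nat \<Rightarrow> nat \<Rightarrow> nat \<Rightarrow> nat \<Rightarrow> nat \<Rightarrow> nat \<Rightarrow> nat \<Rightarrow> bool" where
  "run F N n m t u u' R \<longleftrightarrow> stage F N n m t u u' (b 3) \<and> u < u' \<and> (\<exists>M\<ge>3. u' < b M \<and> b M \<le> Suc u' + R)"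

text \<open>
  Both times are free by \<open>large_both_free\<close>, so both indices increase by one. At the end of the block, where
  \<open>u' + 1 = b M\<close>, this is impossible because \<open>Q (u' + 1) = u'\<close> exceeds \<open>Q (u + 1) \<le> u\<close>.
\<close>

lemma run_step:
  fixes F T N
  defines "K \<equiv> Max (F ` {..T})"
  defines "K2 \<equiv> Max (F ` {..T + S K})"
  defines "N' \<equiv> N + T + 2 * (S K + S K2)"
  assumes run: "run F N' n m t u u' R" and t: "t \<le> T"
  obtains d where "d \<le> S K" "0 < R" "run F N n m (t + d) (Suc u) (Suc u') (R - 1)"
proof -
  from run have st: "stage F N' n m t u u' (b 3)" and uu: "u < u'" by (auto simp: run_def)
  obtain M where M: "3 \<le> M" "u' < b M" "b M \<le> Suc u' + R" using run by (auto simp: run_def)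
  from st have tw: "twins F N' n m" and g: "free_or_tied (n + t) u" "free_or_tied (m + t) u'"
    and large: "b 3 \<le> u" "b 3 \<le> u'" by (auto simp: stage_def)
  obtain \<kappa> where k: "breaks e S (n + t) \<kappa>" using ex_breaks[of "n + t"] tw by (auto simp: twins_def)
  have "\<kappa> \<le> F t" using tw k t by (auto simp: twins_def N'_def)
  then have kK: "\<kappa> \<le> K" using F_bound[OF t, of F] by (simp add: K_def)
  then have Sk: "S \<kappa> \<le> S K" "S (\<kappa> - 1) \<le> S K" by auto
  \<comment> \<open>If \<open>n + t\<close> were tied, then \<open>\<kappa> - 1 = Q (u + 1)\<close>, and the time considered here would be the \<open>p\<close> of \<open>tied_breaks\<close>.\<close>
  obtain \<mu> where l: "breaks e S (n + t + S (\<kappa> - 1)) \<mu>"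
    using ex_breaks[of "n + t + S (\<kappa> - 1)"] tw by (auto simp: twins_def)
  have bd: "t + z \<le> T + S K" "t + z \<le> N'" if "z \<le> S K" for z
    using t that unfolding N'_def by auto
  have "\<mu> \<le> F (t + S (\<kappa> - 1))" using tw l bd(2)[OF Sk(2)] by (auto simp: twins_def add.assoc)
  also have "\<dots> \<le> K2" unfolding K2_def by (rule F_bound[OF bd(1)[OF Sk(2)]])
  finally have Sl: "S \<mu> \<le> S K2" by simp
  have "e (n + t + y) = e (m + t + y)" if "1 \<le> y" "y \<le> 2 * (S \<kappa> + S \<mu>)" for y
  proof -
    have "t + y \<le> N'" using that t Sk(1) Sl by (simp del: S_le_iff add: N'_def)
    then show ?thesis using tw that by (simp add: twins_def add.assoc)
  qed
  then have fr: "free (n + t) u" "free (m + t) u'" "Q (Suc u) = \<kappa>" "Q (Suc u') = \<kappa>"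
    using large_both_free[OF g large _ k l] uu by auto
  have ne: "b M \<noteq> Suc u'"
  proof
    assume "b M = Suc u'"
    then have "Q (Suc u') = u'" using Q_b[of M] M by simp
    then show False using fr Q_le[of u] uu by simp
  qed
  have v: "suffix_index (n + (t + S \<kappa>)) (Suc u)" "suffix_index (m + (t + S \<kappa>)) (Suc u')"
    using free_next[OF fr(1)] free_next[OF fr(2)] fr by (simp_all add: add.assoc)
  have "free_or_tied (n + (t + S \<kappa>)) (Suc u)" "free_or_tied (m + (t + S \<kappa>)) (Suc u')"
    using free_or_tied_of_large[OF v(1)] free_or_tied_of_large[OF v(2)] large by auto
  moreover have "twins F N n m" using twins_mono[OF tw, of N] by (simp add: N'_def)
  moreover have "t + S \<kappa> < S (Suc u)" "t + S \<kappa> < S (Suc u')"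
    using st fr S_Suc[of u] S_Suc[of u'] by (auto simp: stage_def)
  ultimately have "stage F N n m (t + S \<kappa>) (Suc u) (Suc u') (b 3)" using large by (simp add: stage_def)
  moreover have "Suc u' < b M" using ne M by simp
  ultimately have "run F N n m (t + S \<kappa>) (Suc u) (Suc u') (R - 1)"
    using uu M unfolding run_def by (intro conjI exI[of _ M]) auto
  moreover have "0 < R" using ne M by (cases R) auto
  ultimately show ?thesis using that Sk by blast
qed

lemma no_run: "\<not> (\<forall>N. \<exists>n m t u u'. t \<le> T \<and> run F N n m t u u' R)"
proof (induction R arbitrary: T)
  case 0
  show ?case
  proof
    assume H: "\<forall>N. \<exists>n m t u u'. t \<le> T \<and> run F N n m t u u' 0"
    then obtain n m t u u' where "t \<le> T"
      "run F (0 + T + 2 * (S (Max (F ` {..T})) + S (Max (F ` {..T + S (Max (F ` {..T}))})))) n m t u u' 0" by blast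
    from run_step[OF this(2,1)] show False by blast
  qed
next
  case (Suc R)
  define K where "K = Max (F ` {..T})"
  show ?case
  proof
    assume H: "\<forall>N. \<exists>n m t u u'. t \<le> T \<and> run F N n m t u u' (Suc R)"
    have "\<exists>n m t u u'. t \<le> T + S K \<and> run F N n m t u u' R" for N
    proof -
      obtain n m t u u' where *: "t \<le> T"
        "run F (N + T + 2 * (S (Max (F ` {..T})) + S (Max (F ` {..T + S (Max (F ` {..T}))})))) n m t u u' (Suc R)"
        using H by blast
      obtain d where "d \<le> S K" "run F N n m (t + d) (Suc u) (Suc u') R"
        using run_step[OF *(2,1)] unfolding K_def by auto
      then show ?thesis using *(1) add_mono by blast
    qed
    then show False using Suc[of "T + S K"] by blast
  qed
qed

text \<open>
  A position \<open>w\<close> that is \<open>m \<ge> 3\<close> steps before the next block has \<open>Q w = b m - 1\<close>, which bounds \<open>m\<close>.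
\<close>

lemma block_end_near:
  assumes "b 3 \<le> w" obtains M s where "3 \<le> M" "b M = w + s" "s \<le> Q w + 3"
proof -
  obtain i j where ij: "3 \<le> i" "j < i" "w = b i + j" using Q_cases[OF assms] .
  have Qm: "Q w = Q (b (i - j))" using Q_block ij by simp
  have "i - j \<le> Q w + 3"
  proof (cases "3 \<le> i - j")
    case True
    then show ?thesis using Qm Q_b b_ge[of "i - j"] by simp
  qed simp
  moreover have "b (Suc i) = w + (i - j)" using ij b_Suc by simp
  ultimately show ?thesis using that ij(1) by (meson le_SucI)
qed

theorem no_twins: "\<not> (\<forall>N. \<exists>n m. twins F N n m)"
proof
  assume "\<forall>N. \<exists>n m. twins F N n m"
  then obtain T where T: "\<And>N. \<exists>n m t u u'. t \<le> T \<and> stage F N n m t u u' (b 3)"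
    using ex_stage[of F "b 3"] by blast
  define R where "R = Max (F ` {..T}) + 3"
  have "\<exists>n m t u u'. t \<le> T \<and> run F N n m t u u' R" for N
  proof -
    have "\<exists>n m t u u'. t \<le> T \<and> stage F (N + T) n m t u u' (b 3) \<and> u < u'"
    proof -
      obtain n m t u u' where *: "t \<le> T" "stage F (N + T) n m t u u' (b 3)" using T by blast
      then have "stage F (N + T) m n t u' u (b 3)" using twins_sym by (auto simp: stage_def)
      then show ?thesis using * stage_ne[OF *(2)] by (meson linorder_neqE_nat)
    qed
    then obtain n m t u u' where *: "t \<le> T" "stage F (N + T) n m t u u' (b 3)" "u < u'" by blast
    obtain M s where M: "3 \<le> M" "b M = Suc u' + s" "s \<le> Q (Suc u') + 3"
      using block_end_near[of "Suc u'"] *(2) by (auto simp: stage_def)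
    have "free_or_tied (m + t) u'" "twins F (N + T) n m" using * by (auto simp: stage_def)
    then have "Q (Suc u') \<le> F t"
      using free_breaks tied_breaks(1) *(1) unfolding free_or_tied_def twins_def
      by (metis Suc_leD le_add2 order_trans)
    then have "s \<le> R" using M F_bound[OF *(1), of F] by (simp add: R_def)
    moreover have "stage F N n m t u u' (b 3)" using * twins_mono[of F "N + T" n m N] by (auto simp: stage_def)
    ultimately have "run F N n m t u u' R" using * M unfolding run_def by (intro conjI exI[of _ M]) auto
    then show ?thesis using * by blast
  qed
  then show False using no_run by blast
qed

end

section \<open>Close returns to the turning point share their past\<close>

context block_kneading
begin

text \<open>
  The last \<open>S (Q p)\<close> symbols up to \<open>S p\<close> copy the initial word of that length, except for the very last one.
\<close>

lemma symbol_before_S: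
  assumes "1 \<le> p" "z < S (Q p)"
  shows "e (S p - z) = (if z = 0 then \<not> e (S (Q p)) else e (S (Q p) - z))"
proof -
  obtain r where r: "p = Suc r" using assms by (cases p) auto
  have br: "breaks e S (S r) (Q p)" using breaks_S[of r] r by simp
  show ?thesis
  proof (cases "z = 0")
    case False
    then have "e (S r + (S (Q p) - z)) = e (S (Q p) - z)"
      using br assms unfolding breaks_def by (intro agreeD) auto
    then show ?thesis using False assms S_Suc[of r] r by simp
  qed (use br S_Suc[of r] r in \<open>simp add: breaks_def\<close>)
qed

lemma same_past:
  assumes "s \<le> l" "s \<le> l'" "\<And>i. i < s \<Longrightarrow> Q (l - i) = Q (l' - i)" "y < s"
  shows "e (S l - y) = e (S l' - y)"
proof -
  have "S l - S (l - s) = S l' - S (l' - s) \<and> (\<forall>y < S l - S (l - s). e (S l - y) = e (S l' - y))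
    \<and> s \<le> S l - S (l - s)"
    using assms(1-3)
  proof (induction s)
    case (Suc s)
    define p where "p = l - Suc s"
    define p' where "p' = l' - Suc s"
    define D where "D = S l - S (Suc p)"
    define g where "g = Q (Suc p)"
    have p: "l - s = Suc p" "l' - s = Suc p'" using Suc.prems by (auto simp: p_def p'_def)
    have g: "Q (Suc p') = g" using Suc.prems(3)[of s] p by (simp add: g_def)
    have IH: "D = S l' - S (Suc p')" "\<And>y. y < D \<Longrightarrow> e (S l - y) = e (S l' - y)" "s \<le> D"
      using Suc.IH Suc.prems p by (auto simp: D_def)
    have "Suc p \<le> l" "Suc p' \<le> l'" using Suc.prems by (auto simp: p_def p'_def)
    then have le: "S (Suc p) \<le> S l" "S (Suc p') \<le> S l'" by auto
    have D: "S l = S (Suc p) + D" "S l' = S (Suc p') + D"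
      using le(1) le_add_diff_inverse[OF le(2)] IH(1) by (simp_all del: S_le_iff add: D_def)
    have "S l - S p = D + S g" "S l' - S p' = D + S g" using D S_Suc[of p] S_Suc[of p'] g by (simp_all add: g_def)
    moreover have "e (S l - y) = e (S l' - y)" if "y < D + S g" for y
    proof (cases "y < D")
      case False
      define z where "z = y - D"
      have z: "z < S g" "S l - y = S (Suc p) - z" "S l' - y = S (Suc p') - z"
        using that False D by (auto simp: z_def)
      show ?thesis using symbol_before_S[of "Suc p" z] symbol_before_S[of "Suc p'" z] z g by (simp add: g_def)
    qed (rule IH(2))
    moreover have "Suc s \<le> D + S g" using IH(3) S_pos[of g] by simp
    ultimately show ?case by (simp add: p_def p'_def)
  qed simp
  then show ?thesis using assms(4) by auto
qed

text \<open>
  Consecutive blocks end with the same values of \<open>Q\<close>, so \<open>same_past\<close> applies.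
\<close>

lemma past_block_end:
  assumes "3 \<le> M" "M \<le> M'" "y < M - 1"
  shows "e (S (b M' - 1) - y) = e (S (b M - 1) - y)"
  using assms(2)
proof (induction M' rule: nat_induct_at_least)
  case (Suc M')
  have *: "b (Suc M') - 1 = b M' + (M' - 1)" "b M' - 1 = b (M' - 1) + (M' - 2)"
    using b_last[of "Suc M'"] b_last[of M'] Suc assms by auto
  have "e (S (b (Suc M') - 1) - y) = e (S (b M' - 1) - y)"
  proof (rule same_past)
    fix i assume i: "i < M' - 1"
    have "b (Suc M') - 1 - i = b M' + (M' - 1 - i)" "b M' - 1 - i = b (M' - 1) + (M' - 2 - i)"
      using * i by auto
    then show "Q (b (Suc M') - 1 - i) = Q (b M' - 1 - i)"
      using Q_block[of "M' - 1 - i" M'] Q_block[of "M' - 2 - i" "M' - 1"] i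
      by (simp add: Suc_diff_Suc numeral_2_eq_2)
  next
    show "M' - 1 \<le> b (Suc M') - 1" "M' - 1 \<le> b M' - 1" using b_ge[of M'] b_ge[of "Suc M'"] Suc assms by auto
  qed (use assms Suc in auto)
  with Suc show ?case by simp
qed simp

text \<open>
  A close return has an index \<open>u\<close> with a large value \<open>Q (u + 1) = b m - 1\<close>. If \<open>u + 1\<close> starts a block, then
  \<open>u\<close> is the end of the previous one. Otherwise \<open>Q u = b (m + 1) - 1\<close> is the end of a block, and \<open>S u\<close> has
  the same past as \<open>S (Q u)\<close>. In both cases \<open>past_block_end\<close> reduces the past to that of \<open>S (b M - 1)\<close>.
\<close>

lemma past_of_close_return:
  assumes q: "1 \<le> q" "agree e q (S (b M + 1))" and M: "3 \<le> M" and y: "1 \<le> y" "y < M - 1"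
  shows "e (q - y) = e (S (b M - 1) - y)"
proof -
  obtain \<kappa> where k: "breaks e S q \<kappa>" using ex_breaks q(1) by blast
  have k1: "b M + 1 < \<kappa>" using breaks_agree_iff[OF k] q(2) by simp
  obtain u where u: "free_or_tied q u" using ex_free_or_tied q(1) by blast
  have Qu: "b M + 1 \<le> Q (Suc u)"
    using u free_breaks tied_breaks(1) breaks_unique[OF k] k1 unfolding free_or_tied_def by fastforce
  have b3M: "b 3 \<le> b M" using b_mono M by simp
  have "b M \<le> u" using Qu Q_le[of u] by simp
  then obtain i j where ij: "3 \<le> i" "j < i" "Suc u = b i + j" using Q_cases[of "Suc u"] b3M by auto
  define m where "m = i - j"
  have Qm: "Q (Suc u) = Q (b m)" using Q_block ij by (simp add: m_def)
  have "M \<le> m"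
  proof (rule ccontr)
    assume "\<not> M \<le> m"
    moreover have "1 \<le> m" using ij by (simp add: m_def)
    ultimately have "b m < b M" "1 \<le> b m" using b_strict_mono[of m M] b_mono[of 1 m] b_1 by auto
    then show False using Qm Qu Q_less[of "b m"] by simp
  qed
  have ySb: "y < S (b M' - 1)" if "M \<le> M'" for M'
    using less_S[of "b M' - 1"] b_ge[of M'] that M y by linarith
  have "\<exists>M'\<ge>M. e (S u - y) = e (S (b M' - 1) - y) \<and> y < S u"
  proof (cases j)
    case 0
    then have "u = b m - 1" using ij by (simp add: m_def)
    then show ?thesis using \<open>M \<le> m\<close> ySb by blast
  next
    case (Suc j')
    then have "Q u = Q (b (Suc m))" using Q_block[of j' i] ij by (simp add: m_def Suc_diff_Suc)
    then have Quu: "Q u = b (Suc m) - 1" using Q_b \<open>M \<le> m\<close> M by simp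
    have "1 \<le> u" using \<open>b M \<le> u\<close> b3M b_3 by simp
    moreover have y': "y < S (Q u)" using Quu ySb[of "Suc m"] \<open>M \<le> m\<close> by simp
    ultimately have "e (S u - y) = e (S (Q u) - y)" using symbol_before_S[of u y] y by simp
    moreover have "y < S u"
      using y' Q_less[OF \<open>1 \<le> u\<close>] S_less_iff[of "Q u" u] by linarith
    ultimately show ?thesis using Quu \<open>M \<le> m\<close> by (intro exI[of _ "Suc m"]) auto
  qed
  then obtain M' where M': "M \<le> M'" "e (S u - y) = e (S (b M' - 1) - y)" "y < S u" by blast
  obtain n0 where "q = n0 + S u" using free_or_tied_suffix_index[OF u] by (auto simp: suffix_index_def)
  then have "suffix_index (q - y + y) u" using free_or_tied_suffix_index[OF u] M' by simp
  then have "e (q - y) = e (S u - y)" using M' by (intro suffix_index_symbol)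
  then show ?thesis using M' past_block_end[OF M M'(1) y(2)] by simp
qed

end

section \<open>Intervals on which an iterate of the tent map is affine\<close>

lemma ivt_strictly_between:
  fixes f :: "real \<Rightarrow> real"
  assumes cont: "continuous_on UNIV f" and "u < v" and sgn: "(f u < y \<and> y < f v) \<or> (f v < y \<and> y < f u)"
  obtains z where "u < z" "z < v" "f z = y"
proof -
  have c: "continuous_on {u..v} f" using cont continuous_on_subset by blast
  have "\<exists>z. u \<le> z \<and> z \<le> v \<and> f z = y"
    using sgn IVT'[of f u y v, OF _ _ _ c] IVT2'[of f v y u, OF _ _ _ c] \<open>u < v\<close> by force
  then obtain z where "u \<le> z" "z \<le> v" "f z = y" by blast
  then show ?thesis using that[of z] sgn by (metis less_irrefl not_less_iff_gr_or_eq order_le_less)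
qed

locale tent_map =
  fixes a :: real
  assumes a_gt_1: "1 < a" and a_le_2: "a \<le> 2"
begin

abbreviation T :: "real \<Rightarrow> real" where "T \<equiv> tent a"

definition c :: "nat \<Rightarrow> real" where "c n = (T ^^ n) (1/2)"

definition e :: "nat \<Rightarrow> bool" where "e n \<longleftrightarrow> 1/2 < c n"

lemma T_left: "x \<le> 1/2 \<Longrightarrow> T x = a * x" and T_right: "1/2 \<le> x \<Longrightarrow> T x = a * (1 - x)"
  using a_gt_1 by (simp_all add: tent_def min_def mult_le_cancel_left)

lemma T_reflect: "T (1 - x) = T x"
  by (simp add: tent_def min.commute)

lemma T_eq_iff: "T x = T y \<longleftrightarrow> x = y \<or> x = 1 - y"
proof
  assume *: "T x = T y"
  show "x = y \<or> x = 1 - y"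
  proof -
    have "a * x = a * y \<or> a * x = a * (1 - y) \<or> a * (1 - x) = a * y \<or> a * (1 - x) = a * (1 - y)"
      using * T_left[of x] T_left[of y] T_right[of x] T_right[of y] by linarith
    then show ?thesis using a_gt_1 by auto
  qed
qed (auto simp: T_reflect)

lemma funpow_reflect: "1 \<le> n \<Longrightarrow> (T ^^ n) (1 - x) = (T ^^ n) x"
  by (cases n) (simp_all add: funpow_Suc_right T_reflect del: funpow.simps)

lemma T_stretch:
  assumes "(x \<le> 1/2 \<and> y \<le> 1/2) \<or> (1/2 \<le> x \<and> 1/2 \<le> y)" shows "\<bar>T x - T y\<bar> = a * \<bar>x - y\<bar>"
proof -
  have "T x - T y = a * (x - y) \<or> T x - T y = - (a * (x - y))"
    using assms T_left[of x] T_left[of y] T_right[of x] T_right[of y] by (auto simp: algebra_simps)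
  then show ?thesis using a_gt_1 by (auto simp: abs_mult)
qed

lemma continuous_T: "continuous_on A T"
  unfolding tent_def [abs_def] by (intro continuous_intros)

lemma continuous_funpow: "continuous_on A (T ^^ n)"
proof (induction n arbitrary: A)
  case (Suc n)
  have "continuous_on A (T \<circ> (T ^^ n))" by (intro continuous_on_compose Suc continuous_T)
  then show ?case by simp
qed (simp add: continuous_on_id)

lemma T_unit: assumes "x \<in> {0..1}" shows "T x \<in> {0..1}"
proof (cases "x \<le> 1/2")
  case True
  have "a * x \<le> 2 * (1/2)" "0 \<le> a * x" using True assms a_gt_1 a_le_2 by (intro mult_mono mult_nonneg_nonneg; simp)+
  then show ?thesis using T_left[OF True] by simp
next
  case False
  have "a * (1 - x) \<le> 2 * (1/2)" "0 \<le> a * (1 - x)"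
    using False assms a_gt_1 a_le_2 by (intro mult_mono mult_nonneg_nonneg; simp)+
  then show ?thesis using T_right[of x] False by simp
qed

lemma c_unit: "c n \<in> {0..1}"
  unfolding c_def by (induction n) (use T_unit in auto)

lemma c_0 [simp]: "c 0 = 1/2" and c_Suc: "c (Suc n) = T (c n)"
  by (simp_all add: c_def)

lemma funpow_c: "(T ^^ m) (c n) = c (n + m)"
  using funpow_add[of m n T] by (simp add: c_def add.commute)

text \<open>
  No interior point of the interval is mapped to the turning point in fewer than \<open>n\<close> steps. Equivalently,
  the \<open>n\<close>-th iterate is affine on the interval, or merely monotone.
\<close>

definition straight :: "nat \<Rightarrow> real \<Rightarrow> real \<Rightarrow> bool" where
  "straight n u v \<longleftrightarrow> (\<forall>m<n. \<forall>x. u < x \<and> x < v \<longrightarrow> (T ^^ m) x \<noteq> 1/2)"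

lemma straight_mono: "straight n u v \<Longrightarrow> m \<le> n \<Longrightarrow> u \<le> u' \<Longrightarrow> v' \<le> v \<Longrightarrow> straight m u' v'"
  unfolding straight_def by force

lemma straight_affine:
  assumes "straight n u v"
  obtains \<sigma> :: real where "\<sigma> = 1 \<or> \<sigma> = -1"
    "\<forall>x\<in>{u..v}. \<forall>y\<in>{u..v}. (T ^^ n) x - (T ^^ n) y = \<sigma> * a ^ n * (x - y)"
proof -
  have "\<exists>\<sigma>::real. (\<sigma> = 1 \<or> \<sigma> = -1) \<and> (\<forall>x\<in>{u..v}. \<forall>y\<in>{u..v}. (T ^^ n) x - (T ^^ n) y = \<sigma> * a ^ n * (x - y))"
    using assms
  proof (induction n)
    case (Suc n)
    then obtain \<sigma> :: real where s: "\<sigma> = 1 \<or> \<sigma> = -1"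
      "\<forall>x\<in>{u..v}. \<forall>y\<in>{u..v}. (T ^^ n) x - (T ^^ n) y = \<sigma> * a ^ n * (x - y)"
      using straight_mono[OF Suc.prems, of n u v] by auto
    have no: "\<not> ((T ^^ n) x < 1/2 \<and> 1/2 < (T ^^ n) y)" if "x \<in> {u..v}" "y \<in> {u..v}" for x y
    proof
      assume *: "(T ^^ n) x < 1/2 \<and> 1/2 < (T ^^ n) y"
      have "min x y < max x y" using * by (cases "x = y") auto
      then obtain z where "min x y < z" "z < max x y" "(T ^^ n) z = 1/2"
        using ivt_strictly_between[of "T ^^ n" "min x y" "max x y" "1/2"] continuous_funpow *
        by (metis min_def max_def)
      then show False using Suc.prems that unfolding straight_def by force
    qed
    consider "\<forall>x\<in>{u..v}. (T ^^ n) x \<le> 1/2" | "\<forall>x\<in>{u..v}. 1/2 \<le> (T ^^ n) x" using no by (meson not_le)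
    then show ?case
    proof cases
      case 1
      have "(T ^^ Suc n) x - (T ^^ Suc n) y = \<sigma> * a ^ Suc n * (x - y)" if "x \<in> {u..v}" "y \<in> {u..v}" for x y
      proof -
        have "(T ^^ Suc n) x - (T ^^ Suc n) y = a * ((T ^^ n) x - (T ^^ n) y)"
          using 1 that by (simp add: T_left right_diff_distrib)
        then show ?thesis using s(2) that by (simp add: mult_ac)
      qed
      then show ?thesis using s(1) by blast
    next
      case 2
      have "(T ^^ Suc n) x - (T ^^ Suc n) y = (- \<sigma>) * a ^ Suc n * (x - y)" if "x \<in> {u..v}" "y \<in> {u..v}" for x y
      proof -
        have "(T ^^ Suc n) x - (T ^^ Suc n) y = - a * ((T ^^ n) x - (T ^^ n) y)"
          using 2 that by (simp add: T_right algebra_simps)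
        then show ?thesis using s(2) that by (simp add: mult_ac)
      qed
      moreover have "- \<sigma> = 1 \<or> - \<sigma> = -1" using s(1) by auto
      ultimately show ?thesis by blast
    qed
  qed (intro exI[of _ 1], simp)
  then show ?thesis using that by blast
qed

text \<open>
  Induction on \<open>n\<close>: the tent map sends an interval on one side of \<open>1/2\<close> onto a nondegenerate interval.
\<close>

lemma not_constant: "u < v \<Longrightarrow> \<exists>x\<in>{u..v}. (T ^^ n) x \<noteq> k"
proof (induction n arbitrary: u v)
  case 0
  then show ?case by (cases "u = k") auto
next
  case (Suc n)
  have a0: "0 < a" using a_gt_1 by simp
  show ?case
  proof (cases "u < 1/2")
    case True
    define v' where "v' = min v (1/2)"
    have "a * u < a * v'" using True Suc.prems a0 by (simp add: v'_def)
    then obtain y where y: "y \<in> {a * u..a * v'}" "(T ^^ n) y \<noteq> k" using Suc.IH by blast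
    define x where "x = y / a"
    have x: "u \<le> x" "x \<le> v'" "a * x = y" using y a0 by (auto simp: x_def field_simps)
    then have "T x = y" using T_left by (simp add: v'_def)
    then show ?thesis using x y by (intro bexI[of _ x]) (auto simp: funpow_Suc_right v'_def simp del: funpow.simps)
  next
    case False
    have "a * (1 - v) < a * (1 - u)" using Suc.prems a0 by simp
    then obtain y where y: "y \<in> {a * (1 - v)..a * (1 - u)}" "(T ^^ n) y \<noteq> k" using Suc.IH by blast
    define x where "x = 1 - y / a"
    have x: "u \<le> x" "x \<le> v" "a * (1 - x) = y" using y a0 by (auto simp: x_def field_simps)
    then have "T x = y" using T_right False by simp
    then show ?thesis using x y by (intro bexI[of _ x]) (auto simp: funpow_Suc_right simp del: funpow.simps)
  qed
qed

text \<open>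
  At the first time \<open>m < n\<close> at which an interior point \<open>x\<close> reaches \<open>1/2\<close>, the map is affine, so points
  at equal distances from \<open>x\<close> become mirror images and have the same image under all later iterates. A
  monotone iterate would then be constant between them.
\<close>

lemma monotone_imp_straight:
  assumes mono: "mono_on {u..v} (T ^^ n) \<or> antimono_on {u..v} (T ^^ n)"
  shows "straight n u v"
proof (rule ccontr)
  assume "\<not> straight n u v"
  then obtain m0 where m0: "m0 < n" "\<exists>x. u < x \<and> x < v \<and> (T ^^ m0) x = 1/2" unfolding straight_def by blast
  then obtain m where m_ex: "\<exists>x. u < x \<and> x < v \<and> (T ^^ m) x = 1/2"
    and least: "\<And>k. k < m \<Longrightarrow> \<not> (\<exists>x. u < x \<and> x < v \<and> (T ^^ k) x = 1/2)"
    using exists_least_iff[of "\<lambda>m. \<exists>x. u < x \<and> x < v \<and> (T ^^ m) x = 1/2"] by blast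
  then obtain x where x: "u < x" "x < v" "(T ^^ m) x = 1/2" by blast
  have "m \<le> m0" using least[of m0] m0 by (meson not_le)
  then have m: "m < n" using m0 by simp
  have "straight m u v" unfolding straight_def using least by blast
  then obtain \<sigma> where s: "\<sigma> = 1 \<or> \<sigma> = -1"
    "\<forall>x\<in>{u..v}. \<forall>y\<in>{u..v}. (T ^^ m) x - (T ^^ m) y = \<sigma> * a ^ m * (x - y)"
    using straight_affine by blast
  define d where "d = min (x - u) (v - x)"
  have d: "0 < d" "x - d \<in> {u..v}" "x + d \<in> {u..v}" using x by (auto simp: d_def)
  have "(T ^^ m) (x + d) - 1/2 = 1/2 - (T ^^ m) (x - d)"
    using s(2)[rule_format, of "x + d" x] s(2)[rule_format, of x "x - d"] d x by auto
  then have refl: "(T ^^ m) (x + d) = 1 - (T ^^ m) (x - d)" by simp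
  have "(T ^^ n) = (T ^^ (n - m)) \<circ> (T ^^ m)" using m by (simp flip: funpow_add)
  then have eq: "(T ^^ n) (x + d) = (T ^^ n) (x - d)" using refl funpow_reflect[of "n - m"] m by simp
  have "(T ^^ n) z = (T ^^ n) (x - d)" if z: "z \<in> {x - d..x + d}" for z
  proof -
    have zuv: "z \<in> {u..v}" using z d by auto
    have le: "x - d \<le> z" "z \<le> x + d" using z by auto
    show ?thesis using mono
    proof
      assume "mono_on {u..v} (T ^^ n)"
      from monotone_onD[OF this d(2) zuv le(1)] monotone_onD[OF this zuv d(3) le(2)] show ?thesis using eq by simp
    next
      assume "antimono_on {u..v} (T ^^ n)"
      from monotone_onD[OF this d(2) zuv le(1)] monotone_onD[OF this zuv d(3) le(2)] show ?thesis using eq by simp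
    qed
  qed
  moreover obtain z where "z \<in> {x - d..x + d}" "(T ^^ n) z \<noteq> (T ^^ n) (x - d)"
    using not_constant[of "x - d" "x + d" n "(T ^^ n) (x - d)"] d(1) by auto
  ultimately show False by blast
qed

lemma straight_imp_monotone:
  assumes "straight n u v"
  shows "mono_on {u..v} (T ^^ n) \<or> antimono_on {u..v} (T ^^ n)"
proof -
  obtain \<sigma> where s: "\<sigma> = 1 \<or> \<sigma> = -1"
    "\<forall>x\<in>{u..v}. \<forall>y\<in>{u..v}. (T ^^ n) x - (T ^^ n) y = \<sigma> * a ^ n * (x - y)"
    using straight_affine[OF assms] by blast
  have nn: "0 \<le> a ^ n * (y - x)" if "x \<le> y" for x y using a_gt_1 that by simp
  show ?thesis using s(1)
  proof
    assume "\<sigma> = 1"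
    then have "(T ^^ n) x \<le> (T ^^ n) y" if "x \<in> {u..v}" "y \<in> {u..v}" "x \<le> y" for x y
      using s(2)[rule_format, of y x] that nn[of x y] by simp
    then show ?thesis by (intro disjI1 monotone_onI)
  next
    assume "\<sigma> = -1"
    then have "(T ^^ n) y \<le> (T ^^ n) x" if "x \<in> {u..v}" "y \<in> {u..v}" "x \<le> y" for x y
      using s(2)[rule_format, of y x] that nn[of x y] by simp
    then show ?thesis by (intro disjI2 monotone_onI)
  qed
qed

lemma monotone_interval_iff:
  assumes "u \<le> v"
  shows "monotone_interval a n {u..v} \<longleftrightarrow> 0 \<le> u \<and> v \<le> 1 \<and> straight n u v"
proof -
  have "(\<exists>u' v'. 0 \<le> u' \<and> u' \<le> v' \<and> v' \<le> 1 \<and> {u..v} = {u'..v'}) \<longleftrightarrow> 0 \<le> u \<and> v \<le> 1"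
    using assms by (auto simp: Icc_eq_Icc)
  then show ?thesis unfolding monotone_interval_def
    using straight_imp_monotone monotone_imp_straight by blast
qed

lemma straight_reflect: "straight n u (1/2) \<longleftrightarrow> straight n (1/2) (1 - u)"
proof -
  have *: "(T ^^ m) (1 - x) \<noteq> 1/2 \<longleftrightarrow> (T ^^ m) x \<noteq> 1/2" for m x
    using funpow_reflect[of m x] by (cases "m = 0") (auto simp del: funpow.simps)
  show ?thesis
  proof
    assume L: "straight n u (1/2)"
    show "straight n (1/2) (1 - u)" unfolding straight_def
    proof (intro allI impI)
      fix m x assume "m < n" "1/2 < x \<and> x < 1 - u"
      then have "(T ^^ m) (1 - x) \<noteq> 1/2" using L unfolding straight_def by auto
      then show "(T ^^ m) x \<noteq> 1/2" using * by blast
    qed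
  next
    assume L: "straight n (1/2) (1 - u)"
    show "straight n u (1/2)" unfolding straight_def
    proof (intro allI impI)
      fix m x assume "m < n" "u < x \<and> x < 1/2"
      then have "(T ^^ m) (1 - x) \<noteq> 1/2" using L unfolding straight_def by auto
      then show "(T ^^ m) x \<noteq> 1/2" using * by blast
    qed
  qed
qed

end

section \<open>Central branches and cutting times\<close>

locale aperiodic_tent_map = tent_map +
  assumes aperiodic: "1 \<le> n \<Longrightarrow> c n \<noteq> 1/2"
begin

text \<open>
  The left central branch exists: \<open>u\<close> is the infimum of the left endpoints of straight intervals up to
  \<open>1/2\<close>. Intervals with \<open>u < 1/2\<close> exist because \<open>1/2\<close> is not periodic.
\<close>

lemma ex_central_endpoint:
  shows "\<exists>u. 0 \<le> u \<and> u < 1/2 \<and> straight n u (1/2) \<and> (\<forall>u'\<ge>0. straight n u' (1/2) \<longrightarrow> u \<le> u')"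
proof -
  define A where "A = {u. 0 \<le> u \<and> u < 1/2 \<and> straight n u (1/2)}"
  have "\<forall>m\<in>{1..<n}. eventually (\<lambda>x. (T ^^ m) x \<noteq> 1/2) (at (1/2))"
  proof
    fix m assume m: "m \<in> {1..<n}"
    have "isCont (T ^^ m) (1/2)" using continuous_funpow[of UNIV m] by (simp add: continuous_on_eq_continuous_at)
    then have "((T ^^ m) \<longlongrightarrow> c m) (at (1/2))" by (simp add: isCont_def c_def)
    then show "eventually (\<lambda>x. (T ^^ m) x \<noteq> 1/2) (at (1/2))"
      using aperiodic[of m] m by (intro tendsto_imp_eventually_ne) auto
  qed
  then have "eventually (\<lambda>x. \<forall>m\<in>{1..<n}. (T ^^ m) x \<noteq> 1/2) (at (1/2))"
    by (intro eventually_ball_finite) auto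
  then obtain d where d: "d > 0" "\<And>x. x \<noteq> 1/2 \<Longrightarrow> dist x (1/2) < d \<Longrightarrow> \<forall>m\<in>{1..<n}. (T ^^ m) x \<noteq> 1/2"
    unfolding eventually_at by blast
  have "straight n (max 0 (1/2 - d)) (1/2)" unfolding straight_def
  proof (intro allI impI)
    fix m x assume m: "m < n" and x: "max 0 (1/2 - d) < x \<and> x < 1/2"
    have "dist x (1/2) < d" using x by (auto simp: dist_real_def)
    then show "(T ^^ m) x \<noteq> 1/2" using d(2)[of x] x m by (cases "m = 0") auto
  qed
  then have ne: "max 0 (1/2 - d) \<in> A" using d(1) by (simp add: A_def max_def)
  have bd: "bdd_below A" unfolding A_def by (rule bdd_belowI[of _ 0]) simp
  define u where "u = Inf A"
  have le: "u \<le> x" if "x \<in> A" for x using bd that by (simp add: u_def cInf_lower)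
  have u1: "0 \<le> u" unfolding u_def using ne by (intro cInf_greatest) (auto simp: A_def)
  have u2: "u < 1/2" using le[OF ne] ne by (simp add: A_def)
  have u3: "straight n u (1/2)" unfolding straight_def
  proof (intro allI impI)
    fix m x assume m: "m < n" and x: "u < x \<and> x < 1/2"
    then obtain u' where "u' \<in> A" "u' < x" using ne cInf_lessD[of A x] unfolding u_def by blast
    then show "(T ^^ m) x \<noteq> 1/2" using m x by (auto simp: A_def straight_def)
  qed
  have u4: "u \<le> u'" if "0 \<le> u'" "straight n u' (1/2)" for u'
    using le[of u'] that u2 by (cases "u' < 1/2") (auto simp: A_def)
  show ?thesis by (intro exI[of _ u] conjI allI impI u1 u2 u3 u4)
qed

text \<open>
  The only candidates for a central branch are \<open>{u..1/2}\<close> and its mirror image, and these have the same image.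
\<close>

lemma central_image_eq:
  assumes n: "1 \<le> n" and u: "0 \<le> u" "u < 1/2" "straight n u (1/2)"
    and min: "\<forall>u'\<ge>0. straight n u' (1/2) \<longrightarrow> u \<le> u'"
  shows "central_image a n = (T ^^ n) ` {u..1/2}"
proof -
  have tp: "turning_pt = 1/2" by (simp add: turning_pt_def)
  have not_inner: "\<not> (x < 1/2 \<and> 1/2 < y)" if "straight n x y" for x y
    using that n unfolding straight_def by (metis funpow_0 less_le_trans zero_less_one)
  have fr: "frontier {x..y} = {x, y}" if "x \<le> y" for x y :: real
    using that by (cases "x = y") (auto simp: frontier_def)
  have left: "central_branch a n {u..1/2}" unfolding central_branch_def
  proof (intro conjI allI impI)
    show "monotone_interval a n {u..1/2}" using u monotone_interval_iff by simp
    show "turning_pt \<in> frontier {u..1/2}" using u fr tp by simp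
    fix J' assume J': "monotone_interval a n J' \<and> {u..1/2} \<subseteq> J'"
    then obtain x y where xy: "x \<le> y" "J' = {x..y}" unfolding monotone_interval_def by blast
    then have *: "0 \<le> x" "straight n x y" using J' monotone_interval_iff by auto
    have sub: "x \<le> u" "1/2 \<le> y" using J' xy u by auto
    have "y = 1/2" using not_inner[OF *(2)] sub u by auto
    moreover have "u \<le> x" using min[rule_format, OF *(1)] *(2) unfolding calculation by blast
    ultimately show "J' = {u..1/2}" using sub xy by simp
  qed
  have img: "(T ^^ n) ` J = (T ^^ n) ` {u..1/2}" if J: "central_branch a n J" for J
  proof -
    from J obtain x y where xy: "x \<le> y" "J = {x..y}" unfolding central_branch_def monotone_interval_def by blast
    then have *: "0 \<le> x" "y \<le> 1" "straight n x y" using J monotone_interval_iff unfolding central_branch_def by auto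
    have max: "J' = J" if "monotone_interval a n J'" "J \<subseteq> J'" for J'
      using J that unfolding central_branch_def by blast
    have "1/2 = x \<or> 1/2 = y" using J fr xy tp unfolding central_branch_def by auto
    then show ?thesis
    proof
      assume y: "1/2 = y"
      have "u \<le> x" using min * y by simp
      then have "{u..1/2} = J" using xy y left by (intro max) (auto simp: central_branch_def)
      then show ?thesis by simp
    next
      assume x: "1/2 = x"
      have "straight n (1/2) y" using *(3) unfolding x[symmetric] .
      then have "straight n (1 - y) (1/2)" using straight_reflect[of n "1 - y"] by simp
      then have uy: "u \<le> 1 - y" using min * by simp
      have "{1/2..1 - u} = J"
      proof (rule max)
        show "monotone_interval a n {1/2..1 - u}" using u monotone_interval_iff straight_reflect by auto
        show "J \<subseteq> {1/2..1 - u}" using xy x uy by auto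
      qed
      moreover have "(\<lambda>x. 1 - x) ` {u..1/2} = {1/2..1 - u}" by (simp add: image_diff_atLeastAtMost)
      ultimately have "J = (\<lambda>x. 1 - x) ` {u..1/2}" by (rule trans[OF sym sym])
      then have "(T ^^ n) ` J = (\<lambda>x. (T ^^ n) (1 - x)) ` {u..1/2}" by (simp only: image_image)
      then show ?thesis by (simp only: funpow_reflect[OF n])
    qed
  qed
  show ?thesis unfolding central_image_def
  proof (rule the_equality)
    show "\<forall>J. central_branch a n J \<longrightarrow> (T ^^ n) ` J = (T ^^ n) ` {u..1/2}" using img by blast
    fix D assume "\<forall>J. central_branch a n J \<longrightarrow> (T ^^ n) ` J = D"
    from this[rule_format, OF left] show "D = (T ^^ n) ` {u..1/2}" by (rule sym)
  qed
qed

text \<open>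
  A time \<open>n\<close> is a cutting time if and only if there is a closest point left of \<open>1/2\<close> that reaches \<open>1/2\<close>
  after \<open>n\<close> steps, in the sense that no point in between reaches \<open>1/2\<close> earlier.
\<close>

lemma cutting_iff:
  assumes "1 \<le> n"
  shows "is_cutting_time a n \<longleftrightarrow> (\<exists>x. 0 \<le> x \<and> x < 1/2 \<and> (T ^^ n) x = 1/2 \<and> straight n x (1/2))"
proof -
  obtain u where u: "0 \<le> u" "u < 1/2" "straight n u (1/2)" and min: "\<forall>u'\<ge>0. straight n u' (1/2) \<longrightarrow> u \<le> u'"
    using ex_central_endpoint[of n] by (elim exE conjE) (rule that)
  have D: "is_cutting_time a n \<longleftrightarrow> (\<exists>x\<in>{u..1/2}. (T ^^ n) x = 1/2)"
  proof -
    have "is_cutting_time a n \<longleftrightarrow> 1/2 \<in> (T ^^ n) ` {u..1/2}"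
      using assms by (simp add: is_cutting_time_def turning_pt_def central_image_eq[OF assms u min])
    also have "\<dots> \<longleftrightarrow> (\<exists>x\<in>{u..1/2}. (T ^^ n) x = 1/2)" unfolding image_iff by (metis (no_types))
    finally show ?thesis .
  qed
  show ?thesis unfolding D
  proof
    assume "\<exists>x\<in>{u..1/2}. (T ^^ n) x = 1/2"
    then obtain x where x: "u \<le> x" "x \<le> 1/2" "(T ^^ n) x = 1/2" by auto
    moreover have "x \<noteq> 1/2" using aperiodic[OF assms] x(3) unfolding c_def by blast
    moreover have "straight n x (1/2)" using straight_mono[OF u(3)] x by auto
    ultimately show "\<exists>x. 0 \<le> x \<and> x < 1/2 \<and> (T ^^ n) x = 1/2 \<and> straight n x (1/2)" using u by (intro exI[of _ x]) auto
  next
    assume "\<exists>x. 0 \<le> x \<and> x < 1/2 \<and> (T ^^ n) x = 1/2 \<and> straight n x (1/2)"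
    then obtain x where "0 \<le> x" "x < 1/2" "(T ^^ n) x = 1/2" "straight n x (1/2)" by blast
    then show "\<exists>x\<in>{u..1/2}. (T ^^ n) x = 1/2" using min by (intro bexI[of _ x]) auto
  qed
qed

lemma straight_extend:
  assumes "straight k x (1/2)" and "x < 1/2" "1 \<le> k"
    and side: "(1/2 \<le> (T ^^ k) x \<and> 1/2 < c k) \<or> ((T ^^ k) x \<le> 1/2 \<and> c k < 1/2)"
  shows "straight (Suc k) x (1/2)"
  unfolding straight_def
proof (intro allI impI)
  fix m z assume m: "m < Suc k" and z: "x < z \<and> z < 1/2"
  show "(T ^^ m) z \<noteq> 1/2"
  proof (cases "m = k")
    case True
    obtain \<sigma> where s: "\<sigma> = 1 \<or> \<sigma> = -1"
      "\<forall>p\<in>{x..1/2}. \<forall>q\<in>{x..1/2}. (T ^^ k) p - (T ^^ k) q = \<sigma> * a ^ k * (p - q)"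
      using straight_affine[OF assms(1)] by blast
    have "0 < a ^ k * (z - x)" "0 < a ^ k * (1/2 - z)" using a_gt_1 z by auto
    moreover have "(T ^^ k) z - (T ^^ k) x = \<sigma> * (a ^ k * (z - x))" "c k - (T ^^ k) z = \<sigma> * (a ^ k * (1/2 - z))"
      using s(2)[rule_format, of z x] s(2)[rule_format, of "1/2" z] z by (auto simp: c_def mult.assoc)
    ultimately show ?thesis using s(1) side True by auto
  qed (use assms m z in \<open>auto simp: straight_def\<close>)
qed

text \<open>
  As long as the orbits of \<open>x\<close> and \<open>1/2\<close> stay on the same side of \<open>1/2\<close>, the interval between them is mapped
  affinely. The two alternatives for \<open>i\<close> and \<open>j\<close> cover both applications: \<open>x\<close> has the future of
  \<open>c m\<close>, or \<open>x\<close> reaches \<open>1/2\<close> at time \<open>m\<close>.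
\<close>

lemma straight_of_agree:
  assumes "x < 1/2" "1 \<le> k" "straight k x (1/2)" and agree: "agree e m L"
    and orb: "\<And>y. (T ^^ (k + y)) x = c (i + y)" "\<And>y. c (k + y) = c (j + y)"
    and ij: "(i = m + 1 \<and> j = 1) \<or> (i = 1 \<and> j = m + 1)"
  shows "straight (k + L) x (1/2)"
  using agree
proof (induction L)
  case (Suc L)
  then have "agree e m L" using agree_mono by force
  then have IH: "straight (k + L) x (1/2)" by (rule Suc.IH)
  have "e (m + Suc L) = e (Suc L)" using agreeD[OF Suc.prems, of "Suc L"] by simp
  then have "(1/2 < c (i + L) \<and> 1/2 < c (j + L)) \<or> (c (i + L) < 1/2 \<and> c (j + L) < 1/2)"
    using ij aperiodic[of "m + Suc L"] aperiodic[of "Suc L"] unfolding e_def by auto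
  then show ?case using straight_extend[OF IH] assms by auto
qed (use assms in simp)

lemma cutting_of_crossing:
  assumes "0 \<le> x" "x < 1/2" "1 \<le> k" "straight k x (1/2)"
    and "((T ^^ k) x < 1/2 \<and> 1/2 < c k) \<or> (c k < 1/2 \<and> 1/2 < (T ^^ k) x)"
  shows "is_cutting_time a k"
proof -
  obtain z where "x < z" "z < 1/2" "(T ^^ k) z = 1/2"
    using ivt_strictly_between[of "T ^^ k" x "1/2" "1/2"] continuous_funpow assms unfolding c_def by blast
  then show ?thesis unfolding cutting_iff[OF assms(3)]
    using straight_mono[OF assms(4), of k z] assms(1) by (intro exI[of _ z]) auto
qed

lemma mismatch_sides: 
  assumes "1 \<le> n" "1 \<le> m" "e n \<noteq> e m"
  shows "(c n < 1/2 \<and> 1/2 < c m) \<or> (c m < 1/2 \<and> 1/2 < c n)"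
  using assms(3) aperiodic[OF assms(1)] aperiodic[OF assms(2)] unfolding e_def
  by (metis linorder_neqE_linordered_idom)

lemma straight_1: "straight 1 x (1/2)"
  by (simp add: straight_def)

text \<open>
  Let \<open>x\<close> be \<open>c m\<close>, reflected to the left of \<open>1/2\<close> if necessary. The interval from \<open>x\<close> to \<open>1/2\<close> is mapped
  affinely until its image is cut by \<open>1/2\<close>, which happens at the first mismatch.
\<close>

lemma mismatch_cutting:
  assumes m: "1 \<le> m" and r: "1 \<le> r" and ag: "agree e m (r - 1)" and ne: "e (m + r) \<noteq> e r"
  shows "is_cutting_time a r"
proof -
  define x where "x = min (c m) (1 - c m)"
  have x: "0 \<le> x" "x < 1/2" using c_unit[of m] aperiodic[OF m] by (auto simp: x_def min_def)
  have orb: "(T ^^ n) x = c (m + n)" if "1 \<le> n" for n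
    using funpow_reflect[OF that, of "c m"] funpow_c[of n m] by (auto simp: x_def min_def)
  have "straight (1 + (r - 1)) x (1/2)"
  proof (rule straight_of_agree[of x 1 m "r - 1" "m + 1" 1])
    show "(T ^^ (1 + y)) x = c (m + 1 + y)" for y using orb[of "1 + y"] by (simp only: add.assoc le_add1)
  qed (use x straight_1 ag in auto)
  then have "straight r x (1/2)" using r by simp
  then show ?thesis
    using cutting_of_crossing[OF x r] mismatch_sides[of "m + r" r] ne orb[OF r] r by auto
qed

text \<open>
  Let \<open>z\<close> be the closest point that reaches \<open>1/2\<close> at time \<open>s\<close>. A closest point for a later cutting time lies in
  the interval from \<open>z\<close> to \<open>1/2\<close>, and the image of that interval at time \<open>s + y\<close> has the endpoints \<open>c y\<close> and
  \<open>c (s + y)\<close>. Hence it is cut when these lie on different sides for the first time.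
\<close>

lemma next_cutting:
  assumes s: "is_cutting_time a s" and r: "1 \<le> r" and ag: "agree e s (r - 1)" and ne: "e (s + r) \<noteq> e r"
  shows "is_cutting_time a (s + r)" "\<And>i. 1 \<le> i \<Longrightarrow> i < r \<Longrightarrow> \<not> is_cutting_time a (s + i)"
proof -
  have s1: "1 \<le> s" using s by (simp add: is_cutting_time_def)
  obtain z where z: "0 \<le> z" "z < 1/2" "(T ^^ s) z = 1/2" "straight s z (1/2)" using s cutting_iff[OF s1] by blast
  have orb: "(T ^^ (s + y)) z = c y" for y
  proof -
    have "(T ^^ (s + y)) z = (T ^^ y) ((T ^^ s) z)" using funpow_add[of y s T] by (simp add: add.commute)
    then show ?thesis unfolding z(3) c_def .
  qed
  have str1: "straight (Suc s) z (1/2)"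
  proof (rule straight_extend[OF z(4,2) s1])
    show "1/2 \<le> (T ^^ s) z \<and> 1/2 < c s \<or> (T ^^ s) z \<le> 1/2 \<and> c s < 1/2"
      unfolding z(3) using aperiodic[OF s1] by linarith
  qed
  have "straight (Suc s + (r - 1)) z (1/2)"
  proof (rule straight_of_agree[of z "Suc s" s "r - 1" 1 "s + 1"])
    show "(T ^^ (Suc s + y)) z = c (1 + y)" for y using orb[of "1 + y"] by simp
  qed (use z ag str1 in auto)
  then have str: "straight (s + r) z (1/2)" using r by simp
  show "is_cutting_time a (s + r)"
    using cutting_of_crossing[OF z(1,2) _ str] mismatch_sides[of "s + r" r] ne orb r by auto
  fix i assume i: "1 \<le> i" "i < r"
  show "\<not> is_cutting_time a (s + i)"
  proof
    assume "is_cutting_time a (s + i)"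
    then obtain x where x: "0 \<le> x" "x < 1/2" "(T ^^ (s + i)) x = 1/2" "straight (s + i) x (1/2)"
      using cutting_iff[of "s + i"] i by auto
    consider "x < z" | "x = z" | "z < x" by linarith
    then show False
    proof cases
      case 1
      then show False using x(4) z i unfolding straight_def by (metis add.right_neutral add_less_cancel_left less_eq_Suc_le One_nat_def)
    next
      case 2
      then show False using x(3) orb[of i] aperiodic[of i] i by simp
    next
      case 3
      then show False using str x i unfolding straight_def by (metis add_less_cancel_left)
    qed
  qed
qed

text \<open>
  While two orbits stay on the same side of \<open>1/2\<close> their distance grows by the factor \<open>a\<close>, but it cannot
  exceed \<open>1\<close>.
\<close>

lemma agree_close:
  assumes "agree e m L" shows "a ^ L * \<bar>c m - 1/2\<bar> \<le> 1"
proof -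
  have eq: "\<bar>c (m + L + 1) - c (L + 1)\<bar> = a ^ (L + 1) * \<bar>c m - 1/2\<bar>"
    using assms
  proof (induction L)
    case 0
    have "\<bar>T (c m) - T (1/2)\<bar> = a * \<bar>c m - 1/2\<bar>" by (rule T_stretch) linarith
    then show ?case by (simp add: c_Suc)
  next
    case (Suc L)
    then have "agree e m L" using agree_mono by force
    have "e (m + Suc L) = e (Suc L)" using agreeD[OF Suc.prems, of "Suc L"] by simp
    then have "\<bar>T (c (m + L + 1)) - T (c (L + 1))\<bar> = a * \<bar>c (m + L + 1) - c (L + 1)\<bar>"
      unfolding e_def by (intro T_stretch) auto
    then show ?case using Suc.IH[OF \<open>agree e m L\<close>] by (simp add: c_Suc mult_ac)
  qed
  have "a ^ L * \<bar>c m - 1/2\<bar> \<le> a ^ (L + 1) * \<bar>c m - 1/2\<bar>"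
    using a_gt_1 by (intro mult_right_mono power_increasing) auto
  also have "\<dots> \<le> 1" using eq c_unit[of "m + L + 1"] c_unit[of "L + 1"] by auto
  finally show ?thesis .
qed

lemma ex_mismatch:
  assumes "1 \<le> m" obtains r where "1 \<le> r" "agree e m (r - 1)" "e (m + r) \<noteq> e r"
proof -
  define \<delta> where "\<delta> = \<bar>c m - 1/2\<bar>"
  have "0 < \<delta>" using aperiodic[OF assms] by (simp add: \<delta>_def)
  obtain L where "1 / \<delta> < a ^ L" using real_arch_pow[OF a_gt_1] by blast
  then have "1 < a ^ L * \<delta>" using \<open>0 < \<delta>\<close> by (simp add: pos_divide_less_eq)
  then have "\<not> agree e m L" using agree_close[of m L] unfolding \<delta>_def by linarith
  then have ex: "\<exists>y. 1 \<le> y \<and> e (m + y) \<noteq> e y" unfolding agree_def by blast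
  then obtain r where r: "1 \<le> r \<and> e (m + r) \<noteq> e r" "\<And>y. y < r \<Longrightarrow> \<not> (1 \<le> y \<and> e (m + y) \<noteq> e y)"
    using exists_least_iff[of "\<lambda>y. 1 \<le> y \<and> e (m + y) \<noteq> e y"] by blast
  have "agree e m (r - 1)" unfolding agree_def
  proof (intro allI impI)
    fix y assume "1 \<le> y \<and> y \<le> r - 1"
    then show "e (m + y) = e y" using r(2)[of y] by auto
  qed
  then show ?thesis using that r(1) by blast
qed

abbreviation S :: "nat \<Rightarrow> nat" where "S \<equiv> cutting_time a"

lemma cutting_1: "is_cutting_time a 1"
proof -
  define x where "x = 1 / (2 * a)"
  have x: "0 \<le> x" "x < 1/2" "a * x = 1/2" using a_gt_1 by (auto simp: x_def field_simps)
  then have "(T ^^ 1) x = 1/2" using T_left[of x] by simp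
  then show ?thesis using cutting_iff[OF order_refl] x(1,2) straight_1 by blast
qed

lemma infinite_cutting: "infinite {n. is_cutting_time a n}"
proof -
  have "\<exists>n>s. is_cutting_time a n" if "is_cutting_time a s" for s
  proof -
    have "1 \<le> s" using that by (simp add: is_cutting_time_def)
    then obtain r where "1 \<le> r" "agree e s (r - 1)" "e (s + r) \<noteq> e r" using ex_mismatch by blast
    then show ?thesis using next_cutting(1)[OF that] by (intro exI[of _ "s + r"]) auto
  qed
  then have unbounded: "\<exists>n>s. n \<in> {n. is_cutting_time a n}" if "s \<in> {n. is_cutting_time a n}" for s
    using that by blast
  show ?thesis
  proof
    assume fin: "finite {n. is_cutting_time a n}"
    have "Max {n. is_cutting_time a n} \<in> {n. is_cutting_time a n}" using fin cutting_1 by (intro Max_in) auto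
    then obtain n where "n > Max {n. is_cutting_time a n}" "n \<in> {n. is_cutting_time a n}" using unbounded by blast
    then show False using Max_ge[OF fin, of n] by simp
  qed
qed

lemma S_cutting: "is_cutting_time a (S k)"
  using enumerate_in_set[OF infinite_cutting] unfolding cutting_time_def by blast

lemma S_surj: "is_cutting_time a n \<Longrightarrow> \<exists>k. S k = n"
  using enumerate_Ex[of "{n. is_cutting_time a n}" n] infinite_cutting unfolding cutting_time_def by blast

lemma strict_mono_S: "strict_mono S"
  using strict_mono_enumerate[OF infinite_cutting] unfolding cutting_time_def strict_mono_def by simp

lemma S_0: "S 0 = 1"
  unfolding cutting_time_def enumerate_0
proof (rule Least_equality)
  show "1 \<in> {n. is_cutting_time a n}" using cutting_1 by blast
  show "1 \<le> n" if "n \<in> {n. is_cutting_time a n}" for n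
    using that unfolding is_cutting_time_def by blast
qed

lemma S_Suc_mismatch:
  obtains r where "S (Suc k) = S k + r" "1 \<le> r" "agree e (S k) (r - 1)" "e (S k + r) \<noteq> e r"
proof -
  have "1 \<le> S k" using S_cutting[of k] by (simp add: is_cutting_time_def)
  then obtain r where r: "1 \<le> r" "agree e (S k) (r - 1)" "e (S k + r) \<noteq> e r" using ex_mismatch by blast
  note nx = next_cutting[OF S_cutting r]
  have "S (Suc k) = (LEAST s. s \<in> {n. is_cutting_time a n} \<and> S k < s)"
    unfolding cutting_time_def by (rule enumerate_Suc''[OF infinite_cutting])
  also have "\<dots> = S k + r"
  proof (rule Least_equality)
    show "S k + r \<in> {n. is_cutting_time a n} \<and> S k < S k + r" using nx(1) r by simp
    fix s assume s: "s \<in> {n. is_cutting_time a n} \<and> S k < s"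
    show "S k + r \<le> s"
    proof (rule ccontr)
      assume "\<not> S k + r \<le> s"
      then have "1 \<le> s - S k" "s - S k < r" using s by auto
      from nx(2)[OF this] show False using s by simp
    qed
  qed
  finally show ?thesis using that r by blast
qed

text \<open>
  The difference of consecutive cutting times is the first mismatch for \<open>S k\<close>, hence a cutting time by
  \<open>mismatch_cutting\<close>, and so the description that defines \<open>kneading_map\<close> has exactly one solution.
\<close>

lemma kneading_map_props:
  "S (Suc k) = S k + S (kneading_map a (Suc k))" "breaks e S (S k) (kneading_map a (Suc k))"
proof -
  obtain r where r: "S (Suc k) = S k + r" "1 \<le> r" "agree e (S k) (r - 1)" "e (S k + r) \<noteq> e r"
    by (rule S_Suc_mismatch)
  have "1 \<le> S k" using S_cutting[of k] by (simp add: is_cutting_time_def)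
  then obtain i where i: "S i = r" using mismatch_cutting r S_surj by blast
  have "kneading_map a (Suc k) = i" unfolding kneading_map_def
  proof (rule the_equality)
    show "S (Suc k) = S (Suc k - 1) + S i" using r i by simp
    fix m assume "S (Suc k) = S (Suc k - 1) + S m"
    then have "S m = S i" using r i by simp
    then show "m = i" using strict_mono_S by (simp add: strict_mono_eq)
  qed
  then show "S (Suc k) = S k + S (kneading_map a (Suc k))" "breaks e S (S k) (kneading_map a (Suc k))"
    using r i by (auto simp: breaks_def)
qed

lemma kneading_tent:
  assumes Q: "\<And>l. 1 \<le> l \<Longrightarrow> Q l = kneading_map a l"
  shows "kneading e S Q"
proof
  show "S 0 = 1" by (rule S_0)
  show "S (Suc k) = S k + S (Q (Suc k))" "breaks e S (S k) (Q (Suc k))" for k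
    using kneading_map_props[of k] Q[of "Suc k"] by simp_all
  show "\<exists>k. breaks e S m k" if m: "1 \<le> m" for m
  proof -
    obtain r where r: "1 \<le> r" "agree e m (r - 1)" "e (m + r) \<noteq> e r" using ex_mismatch[OF m] .
    then obtain k where "S k = r" using mismatch_cutting[OF m] S_surj by blast
    then show ?thesis using r by (auto simp: breaks_def)
  qed
qed

end

section \<open>The omega-limit set of the turning point\<close>

context tent_map
begin

lemma omega_iff: "x \<in> omega_c a \<longleftrightarrow> (\<forall>N. \<forall>\<epsilon>>0. \<exists>n\<ge>N. dist (c n) x < \<epsilon>)"
  unfolding omega_c_def turning_pt_def by (force simp: closure_approachable c_def)

lemma omega_iff_seq: "x \<in> omega_c a \<longleftrightarrow> (\<exists>r. (\<forall>i. i \<le> r i) \<and> (\<lambda>i. c (r i)) \<longlonglongrightarrow> x)"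
proof
  assume "x \<in> omega_c a"
  then have "\<exists>n\<ge>i. dist (c n) x < inverse (real (Suc i))" for i using omega_iff by simp
  then obtain r where r: "\<And>i. i \<le> r i" "\<And>i. dist (c (r i)) x < inverse (real (Suc i))" by metis
  have "(\<lambda>i. dist (c (r i)) x) \<longlonglongrightarrow> 0"
    by (rule tendsto_sandwich[OF _ _ tendsto_const LIMSEQ_inverse_real_of_nat])
       (use r(2) in \<open>auto intro!: always_eventually less_imp_le\<close>)
  then have "(\<lambda>i. c (r i)) \<longlonglongrightarrow> x" using tendsto_dist_iff by blast
  with r(1) show "\<exists>r. (\<forall>i. i \<le> r i) \<and> (\<lambda>i. c (r i)) \<longlonglongrightarrow> x" by blast
next
  assume "\<exists>r. (\<forall>i. i \<le> r i) \<and> (\<lambda>i. c (r i)) \<longlonglongrightarrow> x"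
  then obtain r where r: "\<And>i. i \<le> r i" "(\<lambda>i. c (r i)) \<longlonglongrightarrow> x" by blast
  show "x \<in> omega_c a" unfolding omega_iff
  proof (intro allI impI)
    fix N and \<epsilon> :: real assume "0 < \<epsilon>"
    then obtain i0 where "\<And>i. i0 \<le> i \<Longrightarrow> dist (c (r i)) x < \<epsilon>" using metric_LIMSEQ_D[OF r(2)] by blast
    then have "dist (c (r (max i0 N))) x < \<epsilon>" "N \<le> r (max i0 N)" using r(1)[of "max i0 N"] by auto
    then show "\<exists>n\<ge>N. dist (c n) x < \<epsilon>" by blast
  qed
qed

lemma omega_of_seq: "(\<And>i. i \<le> r i) \<Longrightarrow> (\<lambda>i. c (r i)) \<longlonglongrightarrow> x \<Longrightarrow> x \<in> omega_c a"
  unfolding omega_iff_seq by (intro exI[of _ r] conjI allI)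

lemma compact_omega: "compact (omega_c a)"
proof -
  have "closed (omega_c a)" unfolding omega_c_def by (intro closed_INT ballI closed_closure)
  moreover have "omega_c a \<subseteq> {0..1}"
  proof
    fix x assume "x \<in> omega_c a"
    then obtain r where "(\<lambda>i. c (r i)) \<longlonglongrightarrow> x" using omega_iff_seq by blast
    then show "x \<in> {0..1}" using closed_sequentially[of "{0..1::real}" "\<lambda>i. c (r i)" x] c_unit by blast
  qed
  ultimately show ?thesis using compact_Icc compact_Int_closed inf.absorb2 by metis
qed

lemma orbit_tendsto:
  assumes "(\<lambda>i. c (r i)) \<longlonglongrightarrow> x" shows "(\<lambda>i. c (r i + t)) \<longlonglongrightarrow> (T ^^ t) x"
proof -
  have "isCont (T ^^ t) x" using continuous_funpow[of UNIV t] by (simp add: continuous_on_eq_continuous_at)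
  then have "(\<lambda>i. (T ^^ t) (c (r i))) \<longlonglongrightarrow> (T ^^ t) x" using isCont_tendsto_compose assms by blast
  then show ?thesis by (simp only: funpow_c)
qed

text \<open>
  For surjectivity, a preimage of a limit of \<open>c (r i)\<close> is found as a limit point of \<open>c (r i - 1)\<close>.
\<close>

lemma T_omega: "T ` omega_c a = omega_c a"
proof (intro equalityI subsetI)
  fix y assume "y \<in> T ` omega_c a"
  then obtain x r where r: "y = T x" "\<And>i. i \<le> r i" "(\<lambda>i. c (r i)) \<longlonglongrightarrow> x" using omega_iff_seq by blast
  have "(\<lambda>i. c (r i + 1)) \<longlonglongrightarrow> y" using orbit_tendsto[OF r(3), of 1] r(1) by simp
  moreover have "i \<le> r i + 1" for i using r(2) by (simp add: le_SucI)
  ultimately show "y \<in> omega_c a" by (intro omega_of_seq[of "\<lambda>i. r i + 1"])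
next
  fix y assume "y \<in> omega_c a"
  then obtain r where r: "\<And>i. i \<le> r i" "(\<lambda>i. c (r i)) \<longlonglongrightarrow> y" using omega_iff_seq by blast
  define s where "s = (\<lambda>i. r (Suc i) - 1)"
  have s: "i \<le> s i" "Suc (s i) = r (Suc i)" for i using r(1)[of "Suc i"] by (auto simp: s_def)
  obtain x \<phi> where \<phi>: "strict_mono \<phi>" "(\<lambda>i. c (s (\<phi> i))) \<longlonglongrightarrow> x"
    using seq_compactE[OF compact_imp_seq_compact[OF compact_Icc[of "0::real" 1]], of "\<lambda>i. c (s i)"] c_unit
    unfolding o_def by blast
  have "i \<le> s (\<phi> i)" for i using s(1)[of "\<phi> i"] seq_suble[OF \<phi>(1), of i] by simp
  then have "x \<in> omega_c a" using \<phi>(2) by (intro omega_of_seq[of "\<lambda>i. s (\<phi> i)"])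
  moreover have "T x = y"
  proof (rule LIMSEQ_unique)
    show "(\<lambda>i. c (r (Suc (\<phi> i)))) \<longlonglongrightarrow> T x" using orbit_tendsto[OF \<phi>(2), of 1] s(2) by simp
    have "strict_mono (\<lambda>i. Suc (\<phi> i))" using \<phi>(1) by (simp add: strict_mono_def)
    from LIMSEQ_subseq_LIMSEQ[OF r(2) this] show "(\<lambda>i. c (r (Suc (\<phi> i)))) \<longlonglongrightarrow> y" by (simp add: o_def)
  qed
  ultimately show "y \<in> T ` omega_c a" by blast
qed

lemma homeomorphism_of_inj: "inj_on T (omega_c a) \<Longrightarrow> \<exists>g. homeomorphism (omega_c a) (omega_c a) T g"
  by (rule homeomorphism_compact[OF compact_omega continuous_T T_omega])

lemma periodic_inj:
  assumes "1 \<le> p" "c p = 1/2" shows "inj_on T (omega_c a)"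
proof -
  have per: "c (n + p) = c n" for n
  proof -
    have "c (n + p) = (T ^^ n) (c p)" using funpow_c[of n p] by (simp add: add.commute)
    also have "\<dots> = c n" unfolding assms(2) by (simp add: c_def)
    finally show ?thesis .
  qed
  have "c n = c (n mod p)" for n
  proof (induction n rule: less_induct)
    case (less n)
    show ?case
    proof (cases "n < p")
      case False
      then show ?thesis using per[of "n - p"] less[of "n - p"] assms(1) by (simp add: le_mod_geq)
    qed simp
  qed
  then have "c n \<in> c ` {..<p}" for n using assms(1) by (metis imageI lessThan_iff mod_less_divisor less_eq_Suc_le One_nat_def)
  then have "range c \<subseteq> c ` {..<p}" by blast
  then have fin: "finite (range c)" using finite_subset by blast
  have "omega_c a \<subseteq> range c"
  proof
    fix x assume "x \<in> omega_c a"
    then obtain r where "(\<lambda>i. c (r i)) \<longlonglongrightarrow> x" using omega_iff_seq by blast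
    then show "x \<in> range c"
      using closed_sequentially[OF finite_imp_closed[OF fin], of "\<lambda>i. c (r i)" x] by blast
  qed
  then have "finite (omega_c a)" using fin finite_subset by blast
  then show ?thesis by (rule eq_card_imp_inj_on) (simp add: T_omega)
qed

end

section \<open>No reflected pairs in the omega-limit set\<close>

context aperiodic_tent_map
begin

lemma breaks_bounded:
  assumes K: "kneading e S Q" and lim: "(\<lambda>i. c (f i)) \<longlonglongrightarrow> z" and z: "z \<noteq> 1/2"
  shows "\<exists>B. \<forall>\<^sub>F i in sequentially. \<forall>\<kappa>. breaks e S (f i) \<kappa> \<longrightarrow> \<kappa> \<le> B"
proof -
  interpret K: kneading e S Q by (rule K)
  define \<delta> where "\<delta> = \<bar>z - 1/2\<bar> / 2"
  have \<delta>: "0 < \<delta>" using z by (simp add: \<delta>_def)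
  obtain B where B: "1 / \<delta> < a ^ B" using real_arch_pow[OF a_gt_1] by blast
  have "\<forall>\<^sub>F i in sequentially. dist (c (f i)) z < \<delta>" using tendstoD[OF lim \<delta>] .
  then have "\<forall>\<^sub>F i in sequentially. \<forall>\<kappa>. breaks e S (f i) \<kappa> \<longrightarrow> \<kappa> \<le> B"
  proof (rule eventually_mono, intro allI impI)
    fix i \<kappa> assume d: "dist (c (f i)) z < \<delta>" and br: "breaks e S (f i) \<kappa>"
    show "\<kappa> \<le> B"
    proof (rule ccontr)
      assume "\<not> \<kappa> \<le> B"
      then have le: "B \<le> S \<kappa> - 1" using K.less_S[of \<kappa>] by simp
      have "agree e (f i) (S \<kappa> - 1)" using br by (simp add: breaks_def)
      then have "agree e (f i) B" using agree_mono le by blast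
      then have 1: "a ^ B * \<bar>c (f i) - 1/2\<bar> \<le> 1" by (rule agree_close)
      have "\<bar>z - 1/2\<bar> \<le> \<bar>c (f i) - z\<bar> + \<bar>c (f i) - 1/2\<bar>"
        using abs_triangle_ineq4[of "c (f i) - 1/2" "c (f i) - z"] by simp
      then have "\<delta> \<le> \<bar>c (f i) - 1/2\<bar>" using d by (simp add: \<delta>_def dist_real_def)
      then have "a ^ B * \<delta> \<le> a ^ B * \<bar>c (f i) - 1/2\<bar>" using a_gt_1 by (intro mult_left_mono) auto
      moreover have "1 < a ^ B * \<delta>" using B \<delta> by (simp add: pos_divide_less_eq)
      ultimately show False using 1 by linarith
    qed
  qed
  then show ?thesis by blast
qed

lemma eventually_side:
  assumes "(\<lambda>i. c (f i)) \<longlonglongrightarrow> z" "z \<noteq> 1/2"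
  shows "\<forall>\<^sub>F i in sequentially. e (f i) \<longleftrightarrow> 1/2 < z"
proof (cases "1/2 < z")
  case True
  have "\<forall>\<^sub>F i in sequentially. 1/2 < c (f i)" using order_tendstoD(1)[OF assms(1) True] .
  then show ?thesis by (rule eventually_mono) (use True in \<open>simp add: e_def\<close>)
next
  case False
  then have "z < 1/2" using assms(2) by simp
  have "\<forall>\<^sub>F i in sequentially. c (f i) < 1/2" using order_tendstoD(2)[OF assms(1) \<open>z < 1/2\<close>] .
  then show ?thesis by (rule eventually_mono) (use False in \<open>simp add: e_def\<close>)
qed

lemma eventually_agree:
  assumes "(\<lambda>i. c (f i)) \<longlonglongrightarrow> 1/2" shows "\<forall>\<^sub>F i in sequentially. agree e (f i) L"
proof -
  have "\<forall>\<^sub>F i in sequentially. e (f i + y) = e y" if y: "y \<in> {1..L}" for y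
  proof -
    have "(\<lambda>i. c (f i + y)) \<longlonglongrightarrow> c y" using orbit_tendsto[OF assms, of y] by (simp add: c_def)
    then have "\<forall>\<^sub>F i in sequentially. e (f i + y) \<longleftrightarrow> 1/2 < c y" using eventually_side aperiodic y by auto
    then show ?thesis by (simp add: e_def)
  qed
  then have "\<forall>\<^sub>F i in sequentially. \<forall>y\<in>{1..L}. e (f i + y) = e y" by (intro eventually_ball_finite) auto
  then show ?thesis by (rule eventually_mono) (simp add: agree_def)
qed

text \<open>
  The two cases are separated by whether the orbit of \<open>x\<close> hits \<open>1/2\<close>. If it does at time \<open>t\<close>, then
  the times \<open>r i + t\<close> and \<open>s i + t\<close> are close returns and share their past. If not, \<open>r i\<close> and \<open>s i\<close> are
  twins for every \<open>N\<close>, with bounds \<open>F t\<close> from the distance between \<open>1/2\<close> and the \<open>t\<close>-th image of \<open>x\<close>.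
\<close>

lemma no_reflected_pair:
  assumes K: "block_kneading e S Q b" and x: "x < 1/2" "x \<in> omega_c a" "1 - x \<in> omega_c a"
  shows False
proof -
  interpret K: block_kneading e S Q b by (rule K)
  have kn: "kneading e S Q" by unfold_locales
  obtain r where r: "\<And>i. i \<le> r i" "(\<lambda>i. c (r i)) \<longlonglongrightarrow> x" using x(2) omega_iff_seq by blast
  obtain s where s: "\<And>i. i \<le> s i" "(\<lambda>i. c (s i)) \<longlonglongrightarrow> 1 - x" using x(3) omega_iff_seq by blast
  have rt: "(\<lambda>i. c (r i + t)) \<longlonglongrightarrow> (T ^^ t) x" for t by (rule orbit_tendsto[OF r(2)])
  have st: "(\<lambda>i. c (s i + t)) \<longlonglongrightarrow> (T ^^ t) x" if "1 \<le> t" for t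
    using orbit_tendsto[OF s(2), of t] funpow_reflect[OF that] by simp
  have ne: "\<forall>\<^sub>F i in sequentially. \<not> e (r i) \<and> e (s i)"
    using eventually_conj[OF eventually_side[OF r(2)] eventually_side[OF s(2)]] x(1) by auto
  show False
  proof (cases "\<exists>t. (T ^^ t) x = 1/2")
    case True
    then obtain t where t: "(T ^^ t) x = 1/2" by blast
    have t1: "1 \<le> t" using t x(1) by (cases t) auto
    \<comment> \<open>The symbol \<open>t\<close> steps back is determined by block ends from the block \<open>t + 3\<close> on, as \<open>t < (t + 3) - 1\<close>.\<close>
    define L where "L = S (b (t + 3) + 1)"
    have "\<forall>\<^sub>F i in sequentially. agree e (r i + t) L" "\<forall>\<^sub>F i in sequentially. agree e (s i + t) L"
      using eventually_agree[of "\<lambda>i. r i + t"] eventually_agree[of "\<lambda>i. s i + t"] rt[of t] st[OF t1] t by auto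
    then have "\<forall>\<^sub>F i in sequentially. agree e (r i + t) L \<and> agree e (s i + t) L \<and> \<not> e (r i) \<and> e (s i)"
      using ne by eventually_elim blast
    then obtain i where i: "agree e (r i + t) L" "agree e (s i + t) L" "\<not> e (r i)" "e (s i)"
      using eventually_happens by force
    have "e (r i + t - t) = e (s i + t - t)"
      using K.past_of_close_return[of "r i + t" "t + 3" t] K.past_of_close_return[of "s i + t" "t + 3" t] i t1
      unfolding L_def by simp
    then show False using i by simp
  next
    case False
    have ex: "\<exists>B. \<forall>\<^sub>F i in sequentially. \<forall>\<kappa>. breaks e S (r i + t) \<kappa> \<or> breaks e S (s i + t) \<kappa> \<longrightarrow> \<kappa> \<le> B" for t
    proof -
      obtain B where B: "\<forall>\<^sub>F i in sequentially. \<forall>\<kappa>. breaks e S (r i + t) \<kappa> \<longrightarrow> \<kappa> \<le> B"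
        using breaks_bounded[OF kn rt] False by blast
      have "\<exists>z. (\<lambda>i. c (s i + t)) \<longlonglongrightarrow> z \<and> z \<noteq> 1/2"
      proof (cases "t = 0")
        case True
        then show ?thesis using s(2) x(1) by (intro exI[of _ "1 - x"]) simp
      qed (use st[of t] False in auto)
      then obtain z where "(\<lambda>i. c (s i + t)) \<longlonglongrightarrow> z" "z \<noteq> 1/2" by blast
      from breaks_bounded[OF kn this] obtain B' where B': "\<forall>\<^sub>F i in sequentially. \<forall>\<kappa>. breaks e S (s i + t) \<kappa> \<longrightarrow> \<kappa> \<le> B'"
        by blast
      have "\<forall>\<^sub>F i in sequentially. \<forall>\<kappa>. breaks e S (r i + t) \<kappa> \<or> breaks e S (s i + t) \<kappa> \<longrightarrow> \<kappa> \<le> max B B'"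
        using B B' by eventually_elim (auto simp: le_max_iff_disj)
      then show ?thesis by blast
    qed
    define F where "F t = (SOME B. \<forall>\<^sub>F i in sequentially. \<forall>\<kappa>. breaks e S (r i + t) \<kappa> \<or> breaks e S (s i + t) \<kappa> \<longrightarrow> \<kappa> \<le> B)" for t
    have F: "\<forall>\<^sub>F i in sequentially. \<forall>\<kappa>. breaks e S (r i + t) \<kappa> \<or> breaks e S (s i + t) \<kappa> \<longrightarrow> \<kappa> \<le> F t" for t
      unfolding F_def by (rule someI_ex[OF ex])
    have same: "\<forall>\<^sub>F i in sequentially. e (r i + t) = e (s i + t)" if "1 \<le> t" for t
    proof -
      have "(T ^^ t) x \<noteq> 1/2" using False by blast
      from eventually_side[OF rt this] eventually_side[OF st[OF that] this]
      show ?thesis by eventually_elim simp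
    qed
    have "\<exists>n m. K.twins F N n m" for N
    proof -
      have "\<forall>\<^sub>F i in sequentially. \<forall>t\<in>{1..N}. e (r i + t) = e (s i + t)"
        by (rule eventually_ball_finite) (use same in auto)
      moreover have "\<forall>\<^sub>F i in sequentially. \<forall>t\<in>{..N}. \<forall>\<kappa>. breaks e S (r i + t) \<kappa> \<or> breaks e S (s i + t) \<kappa> \<longrightarrow> \<kappa> \<le> F t"
        by (rule eventually_ball_finite) (use F in auto)
      ultimately have "\<forall>\<^sub>F i in sequentially. K.twins F N (r i) (s i)"
        using ne eventually_ge_at_top[of 1]
      proof eventually_elim
        case (elim i)
        then show ?case using r(1)[of i] s(1)[of i] unfolding K.twins_def by auto
      qed
      then show ?thesis using eventually_happens by force
    qed
    then show False using K.no_twins by blast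
  qed
qed

lemma inj_on_omega:
  assumes "block_kneading e S Q b" shows "inj_on T (omega_c a)"
proof (rule inj_onI, rule ccontr)
  fix x y assume xy: "x \<in> omega_c a" "y \<in> omega_c a" "T x = T y" "x \<noteq> y"
  then have "x = 1 - y" using T_eq_iff by blast
  moreover from this have "x < 1/2 \<or> y < 1/2" using xy by auto
  ultimately show False using no_reflected_pair[OF assms, of x] no_reflected_pair[OF assms, of y] xy by auto
qed

end

theorem theorem3:
  fixes a :: real and k :: "nat \<Rightarrow> nat" and Q :: "nat \<Rightarrow> nat"
  assumes "k 1 \<ge> 1"
    and "k 2 = k 1 + 1"
    and "\<And>i. i \<ge> 3 \<Longrightarrow> int (k i) = 2 * int (k (i - 1)) - int (k (i - 2)) + 1"
    and "1 < a" and "a \<le> 2"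
    and "\<And>l. l \<ge> 1 \<Longrightarrow> Q l = kneading_map a l"
    and "\<And>i. i \<ge> 3 \<Longrightarrow> Q (k i) = k i - 1"
    and "\<And>i j. i \<ge> 2 \<Longrightarrow> 1 \<le> j \<Longrightarrow> j < k (i + 1) - k i \<Longrightarrow>
           Q (k i + j) = Q (k (i - 1) + j - 1)"
    and "\<And>l. 1 \<le> l \<Longrightarrow> l \<le> k 2 + 2 \<Longrightarrow> Q l \<ge> 1 \<Longrightarrow>
           Q (l + 1) > Q (Q (Q l) + 1) + 1"
  shows "\<exists>g. homeomorphism (omega_c a) (omega_c a) (tent a) g"
proof -
  interpret tent_map a by unfold_locales (use assms in auto)
  show ?thesis
  proof (rule homeomorphism_of_inj, cases "\<exists>p\<ge>1. c p = 1/2")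
    case True
    then show "inj_on (tent a) (omega_c a)" using periodic_inj by blast
  next
    case False
    then interpret aperiodic_tent_map a by unfold_locales blast
    have k_Suc: "k (Suc i) = k i + i" if "1 \<le> i" for i
      using that
    proof (induction i rule: nat_induct_at_least)
      case base
      then show ?case using assms(2) by (simp add: numeral_2_eq_2)
    next
      case (Suc i)
      then show ?case using assms(3)[of "Suc (Suc i)"] by simp
    qed
    have "block_kneading (tent_map.e a) (cutting_time a) Q k"
      unfolding block_kneading_def block_kneading_axioms_def
      using kneading_tent[OF assms(6)] assms(1,7,8,9) k_Suc by auto
    then show "inj_on (tent a) (omega_c a)" by (rule inj_on_omega)
  qed
qed

end
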